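(* Let $\mathbb X_1\subseteq\mathbb R^m$ be a nonempty convex open set, let $T:\mathbb X_1\to\mathbb R^d$ and $h:\mathbb X_1\to(0,+\infty)$ be measurable, and put $$\Theta=\Big\{\theta\in\mathbb R^d:\int_{\mathbb X_1}e^{T(x)\cdot\theta}h(x)\,dx<+\infty\Big\},\quad M(\theta)=\log\int_{\mathbb X_1}e^{T(x)\cdot\theta}h(x)\,dx,\quad f(x|\theta)=e^{T(x)\cdot\theta-M(\theta)}h(x).$$ Assume that $\Theta$ is nonempty and open and that $\Lambda$, the interior of the convex hull of the support of the image under $T$ of the measure $h(x)\,dx$, is nonempty. Let $\pi(d\theta)=e^{-W(\theta)}\,d\theta$ be a probability measure on $\Theta$ with $W\in C^2(\Theta)$. Put $\mathfrak t_n(x_1,\dots,x_n)=\frac1n\sum_{i=1}^nT(x_i)$ and $$\pi_n(d\theta|x_1,\dots,x_n)=\frac{\big[\prod_{i=1}^nf(x_i|\theta)\big]\,\pi(d\theta)}{\int_\Theta\big[\prod_{i=1}^nf(x_i|\tau)\big]\,\pi(d\tau)}.$$ Suppose that $\mathrm{Hess}[M]\ge\alpha I$ and $\mathrm{Hess}[W]\ge\lambda_*I$ on $\Theta$ in the sense of quadratic forms, for some $\alpha>0$ and $\lambda_*\in\mathbb R$, and that $$\int_\Theta|\theta|^2\exp\{n[\mathfrak t_n(x_1,\dots,x_n)\cdot\theta-M(\theta)]-W(\theta)\}\,d\theta<+\infty$$ for every $n\in\mathbb N$ and $(x_1,\dots,x_n)\in\mathbb X_1^n$. Then for every integer $n\ge1$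 with $n>-\lambda_*/\alpha$ and all $(x_1,\dots,x_n),(y_1,\dots,y_n)\in\mathbb X_1^n$, $$\mathcal W_2\big(\pi_n(d\theta|x_1,\dots,x_n),\pi_n(d\theta|y_1,\dots,y_n)\big)\le\frac{n}{n\alpha+\lambda_*}\,\big|\mathfrak t_n(x_1,\dots,x_n)-\mathfrak t_n(y_1,\dots,y_n)\big|.$$ In addition, if $\nabla M$ is Lipschitz continuous on $\Theta$ with constant $\ell$, then for every such $n$ and all $(x_1,\dots,x_n),(y_1,\dots,y_n)\in\mathbb X_1^n$ (for which $\hat\theta_n$ is defined, i.e. $\mathfrak t_n\in\Lambda$), $$\mathcal W_2\big(\pi_n(d\theta|x_1,\dots,x_n),\pi_n(d\theta|y_1,\dots,y_n)\big)\le\frac{n\ell}{n\alpha+\lambda_*}\,\big|\hat\theta_n(x_1,\dots,x_n)-\hat\theta_n(y_1,\dots,y_n)\big|.$$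
   Context: $\mathcal W_2$ is the 2-Wasserstein distance on probability measures on $\mathbb R^d$ with finite second moment. Under the stated regularity conditions, $\Theta$ is convex, $M$ is analytic and strictly convex, and $\nabla M:\Theta\to\Lambda$ is a smooth diffeomorphism. The maximum likelihood estimator is $\hat\theta_n(x_1,\dots,x_n):=(\nabla M)^{-1}(\mathfrak t_n(x_1,\dots,x_n))$, defined when $\mathfrak t_n(x_1,\dots,x_n)\in\Lambda$. *)

theory Defs
  imports "HOL-Probability.Probability"
begin

section \<open>Gradient, Hessian, class C2\<close>

definition gradient :: "(real^'d \<Rightarrow> real) \<Rightarrow> real^'d \<Rightarrow> real^'d" where
  "gradient f x = (THE D. GDERIV f x :> D)"

definition hessian :: "(real^'d \<Rightarrow> real) \<Rightarrow> real^'d \<Rightarrow> real^'d^'d" where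
  "hessian f x = jacobian (gradient f) (at x)"

text \<open>Only used for open \<open>S\<close>, where the derivatives at points of \<open>S\<close> depend on \<open>f\<close> restricted
  to \<open>S\<close> only.\<close>

definition C2_on :: "(real^'d) set \<Rightarrow> (real^'d \<Rightarrow> real) \<Rightarrow> bool" where
  "C2_on S f \<longleftrightarrow>
     (\<forall>x\<in>S. f differentiable at x) \<and>
     (\<forall>x\<in>S. gradient f differentiable at x) \<and>
     continuous_on S (hessian f)"

definition hessian_ge :: "(real^'d) set \<Rightarrow> (real^'d \<Rightarrow> real) \<Rightarrow> real \<Rightarrow> bool" where
  "hessian_ge S f c \<longleftrightarrow> (\<forall>x\<in>S. \<forall>v. v \<bullet> (hessian f x *v v) \<ge> c * (v \<bullet> v))"

section \<open>The 2-Wasserstein distance\<close>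

definition couplings :: "'a::euclidean_space measure \<Rightarrow> 'a measure \<Rightarrow> ('a \<times> 'a) measure set" where
  "couplings \<mu> \<nu> =
     {\<gamma>. prob_space \<gamma> \<and> sets \<gamma> = sets (borel \<Otimes>\<^sub>M borel) \<and>
         distr \<gamma> borel fst = \<mu> \<and> distr \<gamma> borel snd = \<nu>}"

definition ennreal_sqrt :: "ennreal \<Rightarrow> ennreal" where
  "ennreal_sqrt c = (if c = \<infinity> then \<infinity> else ennreal (sqrt (enn2real c)))"

text \<open>The value is in \<open>[0, \<infinity>]\<close>: it is \<open>\<infinity>\<close> if all couplings have infinite cost, or if there is
  no coupling (in particular if \<open>\<mu>\<close> or \<open>\<nu>\<close> is not a Borel probability measure). On probability
  measures with finite second moment it is the usual finite distance.\<close>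

definition wasserstein2 :: "'a::euclidean_space measure \<Rightarrow> 'a measure \<Rightarrow> ennreal" where
  "wasserstein2 \<mu> \<nu> =
     (INF \<gamma>\<in>couplings \<mu> \<nu>. ennreal_sqrt (\<integral>\<^sup>+ z. ennreal ((dist (fst z) (snd z))\<^sup>2) \<partial>\<gamma>))"

section \<open>Exponential families\<close>

definition measure_support :: "'a::topological_space measure \<Rightarrow> 'a set" where
  "measure_support \<mu> = {y. \<forall>U. open U \<longrightarrow> y \<in> U \<longrightarrow> emeasure \<mu> U > 0}"

text \<open>\<open>X\<close> is the sample space, \<open>T\<close> the sufficient statistic and \<open>h\<close> the base density. The values
  of \<open>T\<close> and \<open>h\<close> outside \<open>X\<close> play no role.\<close>

definition nat_params :: "(real^'m) set \<Rightarrow> (real^'m \<Rightarrow> real^'d) \<Rightarrow> (real^'m \<Rightarrow> real) \<Rightarrow> (real^'d) set" where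
  "nat_params X T h =
     {\<theta>. (\<integral>\<^sup>+ x\<in>X. ennreal (exp (T x \<bullet> \<theta>) * h x) \<partial>lebesgue) < \<infinity>}"

definition log_partition ::
    "(real^'m) set \<Rightarrow> (real^'m \<Rightarrow> real^'d) \<Rightarrow> (real^'m \<Rightarrow> real) \<Rightarrow> real^'d \<Rightarrow> real" where
  "log_partition X T h \<theta> = ln (LINT x:X|lebesgue. exp (T x \<bullet> \<theta>) * h x)"

definition exp_density ::
    "(real^'m) set \<Rightarrow> (real^'m \<Rightarrow> real^'d) \<Rightarrow> (real^'m \<Rightarrow> real) \<Rightarrow> real^'m \<Rightarrow> real^'d \<Rightarrow> real" where
  "exp_density X T h x \<theta> = exp (T x \<bullet> \<theta> - log_partition X T h \<theta>) * h x"

definition mean_params :: "(real^'m) set \<Rightarrow> (real^'m \<Rightarrow> real^'d) \<Rightarrow> (real^'m \<Rightarrow> real) \<Rightarrow> (real^'d) set" where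
  "mean_params X T h =
     interior (convex hull
       (measure_support (distr (density (lebesgue_on X) (\<lambda>x. ennreal (h x))) borel T)))"

text \<open>A sample \<open>(x\<^sub>1, \<dots>, x\<^sub>n)\<close> is a sequence \<open>x\<close> of which only the entries \<open>1, \<dots>, n\<close> are used.\<close>

definition samples :: "(real^'m) set \<Rightarrow> nat \<Rightarrow> (nat \<Rightarrow> real^'m) set" where
  "samples X n = {x. \<forall>i\<in>{1..n}. x i \<in> X}"

definition mean_stat :: "(real^'m \<Rightarrow> real^'d) \<Rightarrow> nat \<Rightarrow> (nat \<Rightarrow> real^'m) \<Rightarrow> real^'d" where
  "mean_stat T n x = (1 / real n) *\<^sub>R (\<Sum>i=1..n. T (x i))"

text \<open>Meaningful only if \<open>mean_stat T n x\<close> lies in \<open>mean_params X T h\<close>, the image of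
  \<open>nat_params X T h\<close> under the gradient of the log-partition function.\<close>

definition mle ::
    "(real^'m) set \<Rightarrow> (real^'m \<Rightarrow> real^'d) \<Rightarrow> (real^'m \<Rightarrow> real) \<Rightarrow> nat \<Rightarrow> (nat \<Rightarrow> real^'m) \<Rightarrow> real^'d" where
  "mle X T h n x =
     inv_into (nat_params X T h) (gradient (log_partition X T h)) (mean_stat T n x)"

section \<open>Prior and posterior\<close>

text \<open>Both are Borel measures on the whole space, concentrated on \<open>\<Theta>\<close>.\<close>

definition prior :: "(real^'d) set \<Rightarrow> (real^'d \<Rightarrow> real) \<Rightarrow> (real^'d) measure" where
  "prior \<Theta> W = density lborel (\<lambda>\<theta>. ennreal (exp (- W \<theta>)) * indicator \<Theta> \<theta>)"

definition posterior ::
    "(real^'m) set \<Rightarrow> (real^'m \<Rightarrow> real^'d) \<Rightarrow> (real^'m \<Rightarrow> real) \<Rightarrow> (real^'d \<Rightarrow> real)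
      \<Rightarrow> nat \<Rightarrow> (nat \<Rightarrow> real^'m) \<Rightarrow> (real^'d) measure" where
  "posterior X T h W n x =
     (let \<pi> = prior (nat_params X T h) W;
          L = (\<lambda>\<theta>. ennreal (\<Prod>i=1..n. exp_density X T h (x i) \<theta>))
      in density \<pi> (\<lambda>\<theta>. L \<theta> / (\<integral>\<^sup>+ \<tau>. L \<tau> \<partial>\<pi>)))"

end

theory Submission
  imports Defs
begin

text \<open>
  Put \<open>a = n t\<^sub>n(x)\<close>, \<open>b = n t\<^sub>n(y)\<close> and \<open>V = n M + W\<close>. The two posteriors have densities \<open>f\<close> and \<open>g\<close>
  proportional to \<open>exp (a \<bullet> \<theta> - V \<theta>)\<close> and \<open>exp (b \<bullet> \<theta> - V \<theta>)\<close> on \<open>\<Theta>\<close>, and \<open>V\<close> is strongly convex with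
  constant \<open>\<kappa> = n \<alpha> + \<lambda>\<close>. The first estimate therefore says that a linear tilt by \<open>a - b\<close> moves a strongly
  log-concave measure by at most \<open>\<bar>a - b\<bar> / \<kappa>\<close> in \<open>\<W>\<^sub>2\<close> (\<open>wasserstein2_tilted_le\<close>).

  The reason is the displacement convexity of entropy. It is used in a multiplicative form: there is a
  coupling \<open>\<gamma>\<close> of \<open>f\<close> and \<open>g\<close> such that, for all \<open>0 < t < 1\<close> and all measurable \<open>w \<ge> 0\<close>,
  \<open>\<integral> w ((1 - t) x + t y) * (f x powr (- (1 - t)) * g y powr (- t)) d\<gamma>(x, y) \<le> \<integral> w z dz\<close>.
  For \<open>w = f\<close>, strong convexity bounds the integrand on the left from below by the exponential of
  \<open>t ((1 - t) \<kappa> / 2 \<bar>x - y\<bar>\<^sup>2 + (a - b) \<bullet> y + c)\<close>, where \<open>c\<close> is the difference of the two log-normalisers.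
  Since \<open>\<integral> f = 1\<close> and \<open>exp s \<ge> 1 + s\<close>, dividing by \<open>t\<close> and letting \<open>t\<close> tend to \<open>0\<close> yields
  \<open>\<kappa> / 2 E\<bar>x - y\<bar>\<^sup>2 + (a - b) \<bullet> E y + c \<le> 0\<close>. The choice \<open>w = g\<close> and the limit \<open>t \<rightarrow> 1\<close> give the same inequality
  with the roles exchanged. In the sum \<open>c\<close> cancels, and \<open>\<kappa> E\<bar>x - y\<bar>\<^sup>2 \<le> (a - b) \<bullet> E (x - y)\<close> remains, which
  by Cauchy-Schwarz is the claim with the sharp constant.

  The coupling \<open>\<gamma>\<close> is the Knothe coupling, which pairs the coordinates one after the other by conditional
  quantiles. In dimension one the displacement inequality compares the increments of the two quantile
  functions by the weighted AM-GM inequality (\<open>quantile_interpolation\<close>); it passes to one more coordinate by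
  disintegrating both densities (\<open>displacement_coupling_insert\<close>).

  To read off strong convexity from the Hessians, \<open>M\<close> has to be twice differentiable; \<open>M\<close> is the logarithm
  of a Laplace transform, which is differentiated under the integral sign (\<open>has_derivative_laplace\<close>).

  For the second estimate one needs \<open>\<nabla>M (\<theta>\<^sub>n) = t\<^sub>n\<close> at the maximum likelihood estimator \<open>\<theta>\<^sub>n\<close>. Every vector \<open>t\<close> is a value
  of \<open>\<nabla>M\<close>, because the strongly convex function \<open>M - t \<bullet> \<theta>\<close> attains its minimum in \<open>\<Theta>\<close>: its sublevel sets
  are bounded by strong convexity and closed by Fatou's lemma (\<open>gradient_log_laplace_surj\<close>). Thus
  \<open>\<bar>t\<^sub>n(x) - t\<^sub>n(y)\<bar> \<le> \<ell> \<bar>\<theta>\<^sub>n(x) - \<theta>\<^sub>n(y)\<bar>\<close>, and the first estimate implies the second.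
\<close>

section \<open>Quantile functions and the displacement inequality on the line\<close>

definition unit_uniform :: "real measure" where
  "unit_uniform = restrict_space lborel {0<..<1}"

definition quantile :: "real measure \<Rightarrow> real \<Rightarrow> real" where
  "quantile N u = Inf {s. u \<le> cdf N s}"

lemma space_unit_uniform [simp]: "space unit_uniform = {0<..<1}"
  by (simp add: unit_uniform_def space_restrict_space)

lemma sets_unit_uniform [measurable_cong]:
  "sets unit_uniform = sets (restrict_space borel {0<..<1})"
  by (simp add: unit_uniform_def sets_restrict_space)

lemma prob_space_unit_uniform: "prob_space unit_uniform"
  by (rule prob_spaceI) (simp add: unit_uniform_def space_restrict_space emeasure_restrict_space)

text \<open>Joint measurability in the parameter and the level, so that conditional quantiles can be inserted
  into product integrals. It follows from the Galois connection \<open>quantile N u \<le> s \<longleftrightarrow> u \<le> cdf N s\<close>, whose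
  right side is measurable by Fubini.\<close>
lemma measurable_quantile:
  fixes p :: "'a \<Rightarrow> real \<Rightarrow> real"
  assumes p [measurable]: "case_prod p \<in> borel_measurable (M \<Otimes>\<^sub>M borel)"
    and p1: "\<And>x. x \<in> space M \<Longrightarrow> (\<integral>\<^sup>+ s. ennreal (p x s) \<partial>lborel) = 1"
  shows "(\<lambda>(x, u). quantile (density lborel (\<lambda>s. ennreal (p x s))) u)
    \<in> borel_measurable (M \<Otimes>\<^sub>M unit_uniform)"
proof (rule borel_measurableI_le)
  fix s :: real
  have [measurable]: "(\<lambda>z. snd z) \<in> borel_measurable (M \<Otimes>\<^sub>M unit_uniform)"
    by (rule measurable_compose[OF measurable_snd])
       (auto simp: unit_uniform_def intro!: measurable_restrict_space1)
  define F where "F x = enn2real (\<integral>\<^sup>+ r. ennreal (p x r) * indicator {..s} r \<partial>lborel)" for x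
  have [measurable]: "F \<in> borel_measurable M"
    unfolding F_def by measurable
  have "{z \<in> space (M \<Otimes>\<^sub>M unit_uniform).
          (case z of (x, u) \<Rightarrow> quantile (density lborel (\<lambda>s. ennreal (p x s))) u) \<le> s}
      = {z \<in> space (M \<Otimes>\<^sub>M unit_uniform). snd z \<le> F (fst z)}"
  proof (intro Collect_cong conj_cong refl)
    fix z assume z: "z \<in> space (M \<Otimes>\<^sub>M unit_uniform)"
    then obtain x u where xu: "z = (x, u)" "x \<in> space M" "0 < u" "u < 1"
      by (auto simp: space_pair_measure)
    have [measurable]: "p x \<in> borel_measurable borel"
      using measurable_Pair2[OF p xu(2)] by simp
    let ?N = "density lborel (\<lambda>s. ennreal (p x s))"
    interpret N: prob_space ?N
      by (rule prob_spaceI) (simp add: emeasure_density p1[OF xu(2)])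
    interpret N: cdf_distribution ?N
      by unfold_locales auto
    have "cdf ?N s = F x"
      by (simp add: cdf_def measure_def emeasure_density F_def)
    then show "(case z of (x, u) \<Rightarrow> quantile (density lborel (\<lambda>s. ennreal (p x s))) u) \<le> s
        \<longleftrightarrow> snd z \<le> F (fst z)"
      using N.pseudoinverse[of u s] xu by (simp add: quantile_def)
  qed
  also have "\<dots> \<in> sets (M \<Otimes>\<^sub>M unit_uniform)"
    by measurable
  finally show "{z \<in> space (M \<Otimes>\<^sub>M unit_uniform).
      (case z of (x, u) \<Rightarrow> quantile (density lborel (\<lambda>s. ennreal (p x s))) u) \<le> s}
      \<in> sets (M \<Otimes>\<^sub>M unit_uniform)" .
qed

lemma quantile_of_density:
  fixes p :: "real \<Rightarrow> real"
  assumes p [measurable]: "p \<in> borel_measurable borel"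
    and p1: "(\<integral>\<^sup>+ s. ennreal (p s) \<partial>lborel) = 1"
  shows mono_on_quantile: "mono_on {0<..<1} (quantile (density lborel (\<lambda>s. ennreal (p s))))"
    and measurable_quantile1:
      "quantile (density lborel (\<lambda>s. ennreal (p s))) \<in> borel_measurable unit_uniform"
    and distr_quantile: "distr unit_uniform borel (quantile (density lborel (\<lambda>s. ennreal (p s))))
      = density lborel (\<lambda>s. ennreal (p s))"
proof -
  let ?N = "density lborel (\<lambda>s. ennreal (p s))"
  interpret N: prob_space ?N
    by (rule prob_spaceI) (simp add: emeasure_density p1)
  interpret N: cdf_distribution ?N
    by unfold_locales auto
  have eq: "quantile ?N = N.I"
    by (simp add: quantile_def fun_eq_iff)
  show "mono_on {0<..<1} (quantile ?N)"
    unfolding eq by (rule N.mono_I)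
  show "quantile ?N \<in> borel_measurable unit_uniform"
    unfolding eq using N.measurable_CI by (simp cong: measurable_cong_sets add: sets_unit_uniform)
  show "distr unit_uniform borel (quantile ?N) = ?N"
    unfolding eq unit_uniform_def by (rule N.distr_I_eq_M)
qed

lemma weighted_am_gm:
  fixes a b t :: real
  assumes "0 \<le> a" "0 \<le> b" "0 < t" "t < 1"
  shows "a powr (1 - t) * b powr t \<le> (1 - t) * a + t * b"
proof (cases "a = 0 \<or> b = 0")
  case True
  then show ?thesis using assms by (auto simp: add_nonneg_nonneg)
next
  case False
  then show ?thesis
    using Youngs_inequality_0[of "1 - t" t a b] assms by simp
qed

text \<open>Formally \<open>Q' = 1 / p(Q)\<close>, so that this is the fundamental theorem of calculus. As an inequality
  it holds for every measurable density: push the integral forward under \<open>Q\<close>, where the density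
  \<open>p\<close> cancels its inverse.\<close>
lemma transport_inverse_density_le:
  fixes p Q :: "real \<Rightarrow> real"
  assumes p [measurable]: "p \<in> borel_measurable borel" and p0: "\<And>s. 0 \<le> p s"
    and Q [measurable]: "Q \<in> borel_measurable unit_uniform"
    and distr: "distr unit_uniform borel Q = density lborel (\<lambda>s. ennreal (p s))"
    and mono: "mono_on {0<..<1} Q"
    and u: "0 < u" "u \<le> v" "v < 1"
  shows "(\<integral>\<^sup>+ r. ennreal (inverse (p (Q r))) * indicator {u..v} r \<partial>unit_uniform)
    \<le> ennreal (Q v - Q u)"
proof -
  have le: "Q u \<le> Q v"
    using u by (intro mono_onD[OF mono]) auto
  have "(\<integral>\<^sup>+ r. ennreal (inverse (p (Q r))) * indicator {u..v} r \<partial>unit_uniform)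
      \<le> (\<integral>\<^sup>+ r. ennreal (inverse (p (Q r))) * indicator {Q u..Q v} (Q r) \<partial>unit_uniform)"
    using u by (intro nn_integral_mono mult_left_mono)
      (auto simp: indicator_def intro!: mono_onD[OF mono])
  also have "\<dots> = (\<integral>\<^sup>+ s. ennreal (inverse (p s)) * indicator {Q u..Q v} s
      \<partial>distr unit_uniform borel Q)"
    by (subst nn_integral_distr) auto
  also have "\<dots> = (\<integral>\<^sup>+ s. ennreal (p s) * (ennreal (inverse (p s)) * indicator {Q u..Q v} s) \<partial>lborel)"
    unfolding distr by (subst nn_integral_density) auto
  also have "\<dots> \<le> (\<integral>\<^sup>+ s. indicator {Q u..Q v} s \<partial>lborel)"
  proof (intro nn_integral_mono)
    fix s
    have "ennreal (p s) * ennreal (inverse (p s)) \<le> 1"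
      using p0[of s] by (cases "p s = 0") (simp_all flip: ennreal_mult')
    then show "ennreal (p s) * (ennreal (inverse (p s)) * indicator {Q u..Q v} s)
        \<le> indicator {Q u..Q v} s"
      by (auto simp: indicator_def)
  qed
  also have "\<dots> = ennreal (Q v - Q u)"
    using le by simp
  finally show ?thesis .
qed

text \<open>An interval need not contain its endpoints; it is exhausted, up to these two points, by compact
  intervals with endpoints in it.\<close>
lemma nn_integral_interval_le:
  fixes J :: "real set" and G :: "real \<Rightarrow> ennreal"
  assumes J: "convex J" "bounded J" and G [measurable]: "G \<in> borel_measurable borel"
    and le: "\<And>u v. u \<in> J \<Longrightarrow> v \<in> J \<Longrightarrow> u \<le> v \<Longrightarrow> (\<integral>\<^sup>+ r. G r * indicator {u..v} r \<partial>lborel) \<le> c"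
  shows "(\<integral>\<^sup>+ r. G r * indicator J r \<partial>lborel) \<le> c"
proof (cases "J = {}")
  case False
  define a b where "a = Inf J" and "b = Sup J"
  have bdd: "bdd_below J" "bdd_above J"
    using J(2) by (auto simp: bounded_imp_bdd_below bounded_imp_bdd_above)
  have sub: "J \<subseteq> {a..b}"
    using bdd by (auto simp: a_def b_def intro: cInf_lower cSup_upper)
  have sup: "{a<..<b} \<subseteq> J"
  proof
    fix x assume "x \<in> {a<..<b}"
    then obtain y z where "y \<in> J" "y < x" "z \<in> J" "x < z"
      using False bdd by (auto simp: a_def b_def cInf_less_iff less_cSup_iff)
    then show "x \<in> J"
      using J(1) by (meson is_interval_convex_1 mem_is_interval_1_I less_imp_le)
  qed
  define K where "K n = {a + 1 / Suc n .. b - 1 / Suc n}" for n :: nat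
  have K: "(\<integral>\<^sup>+ r. G r * indicator (K n) r \<partial>lborel) \<le> c" for n
  proof (cases "a + 1 / Suc n \<le> b - 1 / Suc n")
    case True
    have "0 < 1 / real (Suc n)" by simp
    with True have "a + 1 / Suc n < b" "a < b - 1 / Suc n"
      by linarith+
    with \<open>0 < 1 / real (Suc n)\<close> have "a + 1 / Suc n \<in> {a<..<b}" "b - 1 / Suc n \<in> {a<..<b}"
      by (auto simp del: of_nat_Suc)
    then show ?thesis
      unfolding K_def using True sup by (intro le) auto
  qed (simp add: K_def)
  have inc: "incseq K"
    unfolding K_def incseq_def
    by (auto simp: frac_le intro: order_trans[rotated] add_left_mono diff_left_mono
        simp del: of_nat_Suc)
  have UK: "(\<Union>n. K n) = {a<..<b}"
  proof safe
    fix x n assume "x \<in> K n"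
    then have "a + 1 / real (Suc n) \<le> x" "x \<le> b - 1 / real (Suc n)"
      by (auto simp: K_def simp del: of_nat_Suc)
    moreover have "0 < 1 / real (Suc n)" by simp
    ultimately have "a < x" "x < b" by linarith+
    then show "x \<in> {a<..<b}" by simp
  next
    fix x assume "x \<in> {a<..<b}"
    then have "min (x - a) (b - x) > 0" by auto
    then obtain n where "inverse (real (Suc n)) < min (x - a) (b - x)"
      using reals_Archimedean by blast
    then show "x \<in> (\<Union>n. K n)"
      by (auto simp: K_def inverse_eq_divide simp del: of_nat_Suc intro!: exI[of _ n])
  qed
  have "(\<integral>\<^sup>+ r. G r * indicator J r \<partial>lborel) \<le> (\<integral>\<^sup>+ r. G r * indicator {a<..<b} r \<partial>lborel)"
  proof (rule nn_integral_mono_AE)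
    have "AE r in lborel. r \<noteq> a" "AE r in lborel. r \<noteq> b"
      by (auto intro: AE_lborel_singleton)
    then show "AE r in lborel. G r * indicator J r \<le> G r * indicator {a<..<b} r"
      by eventually_elim (use sub in \<open>force simp: indicator_def\<close>)
  qed
  also have "\<dots> = emeasure (density lborel G) (\<Union>n. K n)"
    by (simp add: UK emeasure_density)
  also have "\<dots> = (SUP n. emeasure (density lborel G) (K n))"
    using inc by (subst SUP_emeasure_incseq) (auto simp: K_def)
  also have "\<dots> \<le> c"
    using K by (intro SUP_least) (simp add: emeasure_density K_def)
  finally show ?thesis .
qed simp

text \<open>Domination by Lebesgue measure passes from intervals to open sets, which are countable disjoint
  unions of intervals, and then to Borel sets by outer regularity.\<close>
lemma emeasure_le_lborel:
  fixes \<nu> :: "real measure"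
  assumes sets: "sets \<nu> = sets borel"
    and le: "\<And>C. open C \<Longrightarrow> connected C \<Longrightarrow> emeasure \<nu> C \<le> emeasure lborel C"
    and A: "A \<in> sets borel"
  shows "emeasure \<nu> A \<le> emeasure lborel A"
proof (rule ennreal_le_epsilon)
  fix e :: real assume "0 < e"
  then obtain U where U: "open U" "A \<subseteq> U" "emeasure lborel (U - A) < e"
    using outer_regular_lborel[OF A] by blast
  have op: "open C" if "C \<in> components U" for C
    using open_components[OF U(1) that] .
  have cnt: "countable (components U)"
    using op pairwise_disjoint_components[of U]
    by (intro countable_disjoint_open_subsets) (auto simp: pairwise_def disjnt_def)
  have disj: "disjoint_family_on (\<lambda>C. C) (components U)"
    using pairwise_disjoint_components[of U] by (auto simp: pairwise_def disjoint_family_on_def)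
  have "emeasure \<nu> A \<le> emeasure \<nu> (\<Union>C\<in>components U. C)"
    using U by (intro emeasure_mono) (auto simp: sets)
  also have "\<dots> = (\<integral>\<^sup>+ C. emeasure \<nu> C \<partial>count_space (components U))"
    using cnt disj op by (intro emeasure_UN_countable) (auto simp: sets)
  also have "\<dots> \<le> (\<integral>\<^sup>+ C. emeasure lborel C \<partial>count_space (components U))"
    using op by (intro nn_integral_mono le) (auto intro: in_components_connected)
  also have "\<dots> = emeasure lborel (\<Union>C\<in>components U. C)"
    using cnt disj op by (intro emeasure_UN_countable[symmetric]) auto
  also have "\<dots> = emeasure lborel A + emeasure lborel (U - A)"
    using U A by (subst plus_emeasure) (auto intro!: arg_cong[where f="emeasure lborel"])
  also have "\<dots> \<le> emeasure lborel A + e"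
    using U by (intro add_left_mono) auto
  finally show "emeasure \<nu> A \<le> emeasure lborel A + e" .
qed

lemma nn_integral_mono_emeasure:
  assumes sets: "sets M = sets N" and le: "\<And>A. A \<in> sets N \<Longrightarrow> emeasure M A \<le> emeasure N A"
  shows "(\<integral>\<^sup>+ x. f x \<partial>M) \<le> (\<integral>\<^sup>+ x. f x \<partial>N)"
proof -
  have sp: "space M = space N"
    using sets by (rule sets_eq_imp_space_eq)
  have "simple_function M g \<longleftrightarrow> simple_function N g" for g :: "'a \<Rightarrow> ennreal"
    by (simp add: simple_function_def sp sets)
  moreover have "integral\<^sup>S M g \<le> integral\<^sup>S N g" if "simple_function N g" for g
    unfolding simple_integral_def sp using that
    by (intro sum_mono mult_left_mono le) (auto simp: simple_function_def)
  ultimately show ?thesis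
    unfolding nn_integral_def by (intro SUP_mono) auto
qed

text \<open>The displacement inequality in dimension one. The map \<open>z = (1 - t) P + t Q\<close> is increasing, so the
  preimage of an interval is an interval. On it the weight is at most \<open>(1 - t) / p(P) + t / q(Q)\<close> by
  AM-GM, and the integral of this is at most the increment of \<open>z\<close>. Hence the image under \<open>z\<close> of the weighted
  uniform measure is dominated by Lebesgue measure on intervals, and so everywhere.\<close>
lemma quantile_interpolation:
  fixes p q P Q :: "real \<Rightarrow> real"
  assumes p [measurable]: "p \<in> borel_measurable borel" and p0: "\<And>s. 0 \<le> p s"
    and q [measurable]: "q \<in> borel_measurable borel" and q0: "\<And>s. 0 \<le> q s"
    and P [measurable]: "P \<in> borel_measurable unit_uniform"
    and Q [measurable]: "Q \<in> borel_measurable unit_uniform"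
    and dP: "distr unit_uniform borel P = density lborel (\<lambda>s. ennreal (p s))"
    and dQ: "distr unit_uniform borel Q = density lborel (\<lambda>s. ennreal (q s))"
    and mP: "mono_on {0<..<1} P" and mQ: "mono_on {0<..<1} Q"
    and t: "0 < t" "t < 1" and w [measurable]: "w \<in> borel_measurable borel"
  shows "(\<integral>\<^sup>+ u. w ((1 - t) * P u + t * Q u) *
            ennreal (p (P u) powr (- (1 - t)) * q (Q u) powr (- t)) \<partial>unit_uniform)
    \<le> (\<integral>\<^sup>+ z. w z \<partial>lborel)"
proof -
  define z where "z u = (1 - t) * P u + t * Q u" for u
  define G where "G u = ennreal (p (P u) powr (- (1 - t)) * q (Q u) powr (- t))" for u
  have [measurable]: "z \<in> borel_measurable unit_uniform" "G \<in> borel_measurable unit_uniform"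
    unfolding z_def G_def by measurable
  have [measurable]: "(\<lambda>r. indicator {u..v} r :: ennreal) \<in> borel_measurable unit_uniform" for u v
    unfolding unit_uniform_def by (rule measurable_restrict_space1) measurable
  define \<nu> where "\<nu> = distr (density unit_uniform G) borel z"
  have mz: "mono_on {0<..<1} z"
    unfolding z_def using t mP mQ
    by (auto simp: mono_on_def intro!: add_mono mult_left_mono)
  have G_le: "G u \<le> ennreal (1 - t) * ennreal (inverse (p (P u))) + ennreal t * ennreal (inverse (q (Q u)))" for u
  proof -
    have "p (P u) powr (- (1 - t)) * q (Q u) powr (- t)
        = inverse (p (P u)) powr (1 - t) * inverse (q (Q u)) powr t"
      unfolding powr_minus using p0[of "P u"] q0[of "Q u"] by (simp add: inverse_powr)
    also have "\<dots> \<le> (1 - t) * inverse (p (P u)) + t * inverse (q (Q u))"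
      using t p0 q0 by (intro weighted_am_gm) auto
    finally show ?thesis
      unfolding G_def using t p0 q0 by (simp add: ennreal_leI flip: ennreal_mult ennreal_plus)
  qed
  have seg: "(\<integral>\<^sup>+ r. G r * indicator {u..v} r \<partial>unit_uniform) \<le> ennreal (z v - z u)"
    if uv: "0 < u" "u \<le> v" "v < 1" for u v
  proof -
    have mono: "P u \<le> P v" "Q u \<le> Q v"
      using uv by (auto intro!: mono_onD[OF mP] mono_onD[OF mQ])
    have "(\<integral>\<^sup>+ r. G r * indicator {u..v} r \<partial>unit_uniform)
      \<le> (\<integral>\<^sup>+ r. ennreal (1 - t) * (ennreal (inverse (p (P r))) * indicator {u..v} r)
            + ennreal t * (ennreal (inverse (q (Q r))) * indicator {u..v} r) \<partial>unit_uniform)"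
      by (intro nn_integral_mono) (use G_le in \<open>auto simp: indicator_def\<close>)
    also have "\<dots> = ennreal (1 - t) * (\<integral>\<^sup>+ r. ennreal (inverse (p (P r))) * indicator {u..v} r \<partial>unit_uniform)
        + ennreal t * (\<integral>\<^sup>+ r. ennreal (inverse (q (Q r))) * indicator {u..v} r \<partial>unit_uniform)"
      by (subst nn_integral_add) (auto simp: nn_integral_cmult)
    also have "\<dots> \<le> ennreal (1 - t) * ennreal (P v - P u) + ennreal t * ennreal (Q v - Q u)"
      by (intro add_mono mult_left_mono transport_inverse_density_le[OF p p0 P dP mP uv]
          transport_inverse_density_le[OF q q0 Q dQ mQ uv]) auto
    also have "\<dots> = ennreal ((1 - t) * (P v - P u) + t * (Q v - Q u))"
      using t mono by (simp flip: ennreal_mult ennreal_plus)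
    also have "\<dots> = ennreal (z v - z u)"
      by (simp add: z_def algebra_simps)
    finally show ?thesis .
  qed
  have int: "emeasure \<nu> C \<le> emeasure lborel C" if C: "open C" "connected C" for C
  proof -
    define J where "J = {u \<in> {0<..<1}. z u \<in> C}"
    have CI: "x \<in> C" if "y \<in> C" "y' \<in> C" "y \<le> x" "x \<le> y'" for x y y'
      using C(2) that by (meson is_interval_connected_1 mem_is_interval_1_I)
    have "is_interval J"
      unfolding is_interval_1
    proof safe
      fix a b x assume ab: "a \<in> J" "b \<in> J" "a \<le> x" "x \<le> b"
      then have "z a \<le> z x" "z x \<le> z b"
        by (auto simp: J_def intro!: mono_onD[OF mz])
      with CI[of "z a" "z b" "z x"] ab show "x \<in> J"
        by (simp add: J_def)
    qed
    then have "convex J"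
      by (rule is_interval_convex)
    moreover have "bounded J"
      by (rule bounded_subset[of "{0<..<1}"]) (auto simp: J_def)
    ultimately have J: "convex J" "bounded J" .
    have [measurable]: "C \<in> sets borel"
      using C by auto
    have "emeasure \<nu> C = (\<integral>\<^sup>+ u. G u * indicator C (z u) \<partial>unit_uniform)"
    proof -
      have "emeasure \<nu> C = (\<integral>\<^sup>+ x. indicator C x \<partial>\<nu>)"
        by (rule nn_integral_indicator[symmetric]) (simp add: \<nu>_def)
      also have "\<dots> = (\<integral>\<^sup>+ u. indicator C (z u) \<partial>density unit_uniform G)"
        unfolding \<nu>_def by (rule nn_integral_distr) auto
      also have "\<dots> = (\<integral>\<^sup>+ u. G u * indicator C (z u) \<partial>unit_uniform)"
        by (rule nn_integral_density) auto
      finally show ?thesis .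
    qed
    also have "\<dots> = (\<integral>\<^sup>+ u. (G u * indicator {0<..<1} u) * indicator J u \<partial>lborel)"
      unfolding unit_uniform_def
      by (subst nn_integral_restrict_space) (auto intro!: nn_integral_cong simp: J_def indicator_def)
    also have "\<dots> \<le> emeasure lborel C"
    proof (rule nn_integral_interval_le[OF J])
      have "G \<in> borel_measurable (restrict_space lborel {0<..<1})"
        using \<open>G \<in> borel_measurable unit_uniform\<close> by (simp add: unit_uniform_def)
      then show "(\<lambda>u. G u * indicator {0<..<1} u) \<in> borel_measurable borel"
        by (subst (asm) borel_measurable_restrict_space_iff_ennreal) auto
    next
      fix u v assume uv: "u \<in> J" "v \<in> J" "u \<le> v"
      have "(\<integral>\<^sup>+ r. (G r * indicator {0<..<1} r) * indicator {u..v} r \<partial>lborel)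
          = (\<integral>\<^sup>+ r. G r * indicator {u..v} r \<partial>unit_uniform)"
        unfolding unit_uniform_def
        by (subst nn_integral_restrict_space) (auto intro!: nn_integral_cong simp: indicator_def)
      also have "\<dots> \<le> ennreal (z v - z u)"
        using uv by (intro seg) (auto simp: J_def)
      also have "\<dots> = emeasure lborel {z u..z v}"
        using uv by (subst emeasure_lborel_Icc) (auto simp: J_def intro!: mono_onD[OF mz])
      also have "\<dots> \<le> emeasure lborel C"
      proof (intro emeasure_mono subsetI)
        fix x assume "x \<in> {z u..z v}"
        with CI[of "z u" "z v" x] uv show "x \<in> C" by (simp add: J_def)
      qed simp
      finally show "(\<integral>\<^sup>+ r. (G r * indicator {0<..<1} r) * indicator {u..v} r \<partial>lborel)
          \<le> emeasure lborel C" .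
    qed
    finally show ?thesis .
  qed
  have "(\<integral>\<^sup>+ u. w (z u) * G u \<partial>unit_uniform) = (\<integral>\<^sup>+ x. w x \<partial>\<nu>)"
    unfolding \<nu>_def by (subst nn_integral_distr) (auto simp: nn_integral_density mult.commute)
  also have "\<dots> \<le> (\<integral>\<^sup>+ x. w x \<partial>lborel)"
  proof (rule nn_integral_mono_emeasure)
    show "sets \<nu> = sets lborel"
      by (simp add: \<nu>_def)
    then show "emeasure \<nu> A \<le> emeasure lborel A" if "A \<in> sets lborel" for A
      using that by (auto intro: emeasure_le_lborel[OF _ int])
  qed
  finally show ?thesis
    by (simp add: z_def G_def)
qed

section \<open>The Knothe coupling\<close>
interpretation lborel_family: product_sigma_finite "\<lambda>_::'i. lborel :: real measure"
  by unfold_locales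

interpretation unit_uniform: prob_space unit_uniform
  by (rule prob_space_unit_uniform)

abbreviation lborel_on :: "'i set \<Rightarrow> ('i \<Rightarrow> real) measure" where
  "lborel_on I \<equiv> Pi\<^sub>M I (\<lambda>_. lborel)"

definition prob_density :: "'a measure \<Rightarrow> ('a \<Rightarrow> real) \<Rightarrow> bool" where
  "prob_density M f \<longleftrightarrow> f \<in> borel_measurable M \<and> (\<forall>x. 0 \<le> f x) \<and>
     (\<integral>\<^sup>+ x. ennreal (f x) \<partial>M) = 1"

definition marginal :: "'i \<Rightarrow> (('i \<Rightarrow> real) \<Rightarrow> real) \<Rightarrow> ('i \<Rightarrow> real) \<Rightarrow> real" where
  "marginal i f x = enn2real (\<integral>\<^sup>+ s. ennreal (f (x(i := s))) \<partial>lborel)"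

text \<open>Where the marginal vanishes or is infinite (in both cases \<open>marginal\<close> is \<open>0\<close>), the conditional
  density is the uniform one, so that it is a probability density for every \<open>x\<close>. These \<open>x\<close> form a null
  set of the marginal measure.\<close>
definition conditional :: "'i \<Rightarrow> (('i \<Rightarrow> real) \<Rightarrow> real) \<Rightarrow> ('i \<Rightarrow> real) \<Rightarrow> real \<Rightarrow> real" where
  "conditional i f x s =
     (if 0 < marginal i f x then f (x(i := s)) / marginal i f x else indicator {0..1} s)"

definition conditional_quantile ::
    "'i \<Rightarrow> (('i \<Rightarrow> real) \<Rightarrow> real) \<Rightarrow> ('i \<Rightarrow> real) \<Rightarrow> real \<Rightarrow> real" where
  "conditional_quantile i f x u = quantile (density lborel (\<lambda>s. ennreal (conditional i f x s))) u"

context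
  fixes I :: "'i set" and i :: 'i and f :: "('i \<Rightarrow> real) \<Rightarrow> real"
  assumes I: "finite I" "i \<notin> I" and f: "prob_density (lborel_on (insert i I)) f"
begin

lemma joint_density_meas: "f \<in> borel_measurable (lborel_on (insert i I))"
  and joint_density_nonneg: "0 \<le> f x"
  and joint_density_int: "(\<integral>\<^sup>+ x. ennreal (f x) \<partial>lborel_on (insert i I)) = 1"
  using f by (auto simp: prob_density_def)

lemma coordinate_upd_meas: "(\<lambda>(x, s). x(i := s)) \<in> measurable (lborel_on I \<Otimes>\<^sub>M borel) (lborel_on (insert i I))"
  using measurable_add_dim[of i I "\<lambda>_. lborel :: real measure"]
  by (simp cong: measurable_cong_sets sets_pair_measure_cong)

lemma joint_density_upd_meas: "(\<lambda>z. f ((fst z)(i := snd z))) \<in> borel_measurable (lborel_on I \<Otimes>\<^sub>M borel)"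
  using measurable_compose[OF coordinate_upd_meas joint_density_meas] by (simp add: case_prod_beta')

lemma joint_density_slice_meas: "x \<in> space (lborel_on I) \<Longrightarrow> (\<lambda>s. f (x(i := s))) \<in> borel_measurable borel"
  using measurable_Pair2[OF joint_density_upd_meas, of x] by simp

lemma marginal_meas: "marginal i f \<in> borel_measurable (lborel_on I)"
  unfolding marginal_def using joint_density_upd_meas
  by (intro borel_measurable_enn2real lborel.borel_measurable_nn_integral)
     (simp add: case_prod_beta')

text \<open>The integral over the last coordinate is finite almost everywhere, since its integral is \<open>1\<close>;
  there the conversion to a real number loses nothing.\<close>
lemma AE_marginal:
  "AE x in lborel_on I. (\<integral>\<^sup>+ s. ennreal (f (x(i := s))) \<partial>lborel) = ennreal (marginal i f x)"
proof -
  have "(\<lambda>x. \<integral>\<^sup>+ s. ennreal (f (x(i := s))) \<partial>lborel) \<in> borel_measurable (lborel_on I)"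
    using joint_density_upd_meas by (intro lborel.borel_measurable_nn_integral) (simp add: case_prod_beta')
  moreover have "(\<integral>\<^sup>+ x. (\<integral>\<^sup>+ s. ennreal (f (x(i := s))) \<partial>lborel) \<partial>lborel_on I) = 1"
    using joint_density_int joint_density_meas I by (subst (asm) lborel_family.product_nn_integral_insert) auto
  ultimately have "AE x in lborel_on I. (\<integral>\<^sup>+ s. ennreal (f (x(i := s))) \<partial>lborel) \<noteq> \<infinity>"
    by (intro nn_integral_noteq_infinite) auto
  then show ?thesis
    by eventually_elim (simp add: marginal_def less_top)
qed

lemma prob_density_marginal: "prob_density (lborel_on I) (marginal i f)"
proof -
  have "(\<integral>\<^sup>+ x. ennreal (marginal i f x) \<partial>lborel_on I)
      = (\<integral>\<^sup>+ x. (\<integral>\<^sup>+ s. ennreal (f (x(i := s))) \<partial>lborel) \<partial>lborel_on I)"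
    using AE_marginal by (intro nn_integral_cong_AE) auto
  also have "\<dots> = 1"
    using joint_density_int joint_density_meas I by (subst (asm) lborel_family.product_nn_integral_insert) auto
  finally show ?thesis
    using marginal_meas by (simp add: prob_density_def marginal_def)
qed

lemma conditional_nonneg: "0 \<le> conditional i f x s"
  by (simp add: conditional_def joint_density_nonneg)

lemma conditional_meas: "case_prod (conditional i f) \<in> borel_measurable (lborel_on I \<Otimes>\<^sub>M borel)"
  using joint_density_upd_meas marginal_meas unfolding conditional_def case_prod_beta' by measurable

lemma conditional_slice_meas:
  "x \<in> space (lborel_on I) \<Longrightarrow> conditional i f x \<in> borel_measurable borel"
  using measurable_Pair2[OF conditional_meas, of x] by simp

lemma conditional_int:
  assumes x: "x \<in> space (lborel_on I)"
  shows "(\<integral>\<^sup>+ s. ennreal (conditional i f x s) \<partial>lborel) = 1"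
proof (cases "0 < marginal i f x")
  case True
  then have "(\<integral>\<^sup>+ s. ennreal (f (x(i := s))) \<partial>lborel) = ennreal (marginal i f x)"
    by (metis ennreal_enn2real enn2real_positive_iff marginal_def)
  moreover have "(\<integral>\<^sup>+ s. ennreal (conditional i f x s) \<partial>lborel)
      = (\<integral>\<^sup>+ s. ennreal (f (x(i := s))) / ennreal (marginal i f x) \<partial>lborel)"
    using True joint_density_nonneg by (simp add: conditional_def divide_ennreal)
  ultimately show ?thesis
    using True joint_density_slice_meas[OF x] by (subst (asm) nn_integral_divide) auto
next
  case False
  then show ?thesis
    by (simp add: conditional_def ennreal_indicator)
qed

lemma AE_density_marginal:
  "AE x in density (lborel_on I) (marginal i f).
     (\<forall>s. f (x(i := s)) = marginal i f x * conditional i f x s)"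
  using marginal_meas by (subst AE_density) (auto simp: conditional_def)

lemma conditional_quantile_meas:
  "(\<lambda>(x, u). conditional_quantile i f x u) \<in> borel_measurable (lborel_on I \<Otimes>\<^sub>M unit_uniform)"
  unfolding conditional_quantile_def using conditional_meas conditional_int
  by (rule measurable_quantile)

lemma conditional_quantile_slice:
  assumes x: "x \<in> space (lborel_on I)"
  shows "mono_on {0<..<1} (conditional_quantile i f x)"
    and "conditional_quantile i f x \<in> borel_measurable unit_uniform"
    and "distr unit_uniform borel (conditional_quantile i f x)
      = density lborel (\<lambda>s. ennreal (conditional i f x s))"
  using quantile_of_density[OF conditional_slice_meas[OF x] conditional_int[OF x]]
  by (simp_all add: conditional_quantile_def[abs_def])

lemma upd_quantile_meas:
  "(\<lambda>(x, u). x(i := conditional_quantile i f x u))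
     \<in> measurable (lborel_on I \<Otimes>\<^sub>M unit_uniform) (lborel_on (insert i I))"
proof -
  have "(\<lambda>z. (fst z, (\<lambda>(x, u). conditional_quantile i f x u) z))
      \<in> measurable (lborel_on I \<Otimes>\<^sub>M unit_uniform) (lborel_on I \<Otimes>\<^sub>M borel)"
    by (intro measurable_Pair measurable_fst conditional_quantile_meas)
  from measurable_compose[OF this coordinate_upd_meas] show ?thesis
    by (simp add: case_prod_beta')
qed

text \<open>Sampling from a joint density: draw all coordinates but one from the marginal, then the last one
  by the conditional quantile of a uniform variable.\<close>
lemma nn_integral_upd_quantile:
  assumes \<phi>: "\<phi> \<in> borel_measurable (lborel_on (insert i I))"
  shows "(\<integral>\<^sup>+ x. (\<integral>\<^sup>+ u. \<phi> (x(i := conditional_quantile i f x u)) \<partial>unit_uniform)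
      \<partial>density (lborel_on I) (marginal i f)) = (\<integral>\<^sup>+ x. ennreal (f x) * \<phi> x \<partial>lborel_on (insert i I))"
proof -
  note \<phi> [measurable] joint_density_meas [measurable] marginal_meas [measurable] 
  have \<phi>_slice: "(\<lambda>s. \<phi> (x(i := s))) \<in> borel_measurable borel" if "x \<in> space (lborel_on I)" for x
    using measurable_Pair2[OF measurable_compose[OF coordinate_upd_meas \<phi>] that] by simp
  have [measurable]: "(\<lambda>x. \<integral>\<^sup>+ u. \<phi> (x(i := conditional_quantile i f x u)) \<partial>unit_uniform)
      \<in> borel_measurable (lborel_on I)"
    using measurable_compose[OF upd_quantile_meas \<phi>]
    by (intro unit_uniform.borel_measurable_nn_integral) (simp add: case_prod_beta')
  have "(\<integral>\<^sup>+ x. (\<integral>\<^sup>+ u. \<phi> (x(i := conditional_quantile i f x u)) \<partial>unit_uniform)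
      \<partial>density (lborel_on I) (marginal i f))
    = (\<integral>\<^sup>+ x. (\<integral>\<^sup>+ s. \<phi> (x(i := s)) \<partial>density lborel (\<lambda>s. ennreal (conditional i f x s)))
      \<partial>density (lborel_on I) (marginal i f))"
  proof (intro nn_integral_cong)
    fix x assume "x \<in> space (density (lborel_on I) (marginal i f))"
    then have x: "x \<in> space (lborel_on I)" by simp
    show "(\<integral>\<^sup>+ u. \<phi> (x(i := conditional_quantile i f x u)) \<partial>unit_uniform)
        = (\<integral>\<^sup>+ s. \<phi> (x(i := s)) \<partial>density lborel (\<lambda>s. ennreal (conditional i f x s)))"
      unfolding conditional_quantile_slice(3)[OF x, symmetric]
      using conditional_quantile_slice(2)[OF x] \<phi>_slice[OF x]
      by (subst nn_integral_distr) auto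
  qed
  also have "\<dots> = (\<integral>\<^sup>+ x. (\<integral>\<^sup>+ s. ennreal (conditional i f x s) * \<phi> (x(i := s)) \<partial>lborel)
      \<partial>density (lborel_on I) (marginal i f))"
    using conditional_slice_meas \<phi>_slice
    by (intro nn_integral_cong, subst nn_integral_density) auto
  also have "\<dots> = (\<integral>\<^sup>+ x. ennreal (marginal i f x) *
      (\<integral>\<^sup>+ s. ennreal (conditional i f x s) * \<phi> (x(i := s)) \<partial>lborel) \<partial>lborel_on I)"
  proof (rule nn_integral_density)
    show "(\<lambda>x. \<integral>\<^sup>+ s. ennreal (conditional i f x s) * \<phi> (x(i := s)) \<partial>lborel)
        \<in> borel_measurable (lborel_on I)"
      using measurable_compose[OF coordinate_upd_meas \<phi>] conditional_meas
      by (intro lborel.borel_measurable_nn_integral) (simp add: case_prod_beta')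
  qed simp
  also have "\<dots> = (\<integral>\<^sup>+ x. (\<integral>\<^sup>+ s. ennreal (f (x(i := s))) * \<phi> (x(i := s)) \<partial>lborel) \<partial>lborel_on I)"
  proof (rule nn_integral_cong_AE)
    show "AE x in lborel_on I. ennreal (marginal i f x) *
        (\<integral>\<^sup>+ s. ennreal (conditional i f x s) * \<phi> (x(i := s)) \<partial>lborel)
      = (\<integral>\<^sup>+ s. ennreal (f (x(i := s))) * \<phi> (x(i := s)) \<partial>lborel)"
      using AE_marginal AE_space
    proof eventually_elim
      case (elim x)
      note sl = joint_density_slice_meas[OF elim(2)] \<phi>_slice[OF elim(2)] conditional_slice_meas[OF elim(2)]
      show ?case
      proof (cases "0 < marginal i f x")
        case True
        then have "ennreal (f (x(i := s))) = ennreal (marginal i f x) * ennreal (conditional i f x s)" for s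
          using conditional_nonneg[of x s]
          by (subst ennreal_mult[symmetric]) (simp_all add: conditional_def)
        then show ?thesis
          using sl by (subst nn_integral_cmult[symmetric]) (auto simp: mult.assoc)
      next
        case False
        then have m: "ennreal (marginal i f x) = 0"
          by (simp add: ennreal_eq_0_iff not_less)
        with elim(1) sl have "AE s in lborel. f (x(i := s)) \<le> 0"
          by (simp add: nn_integral_0_iff_AE ennreal_eq_0_iff)
        then have "(\<integral>\<^sup>+ s. ennreal (f (x(i := s))) * \<phi> (x(i := s)) \<partial>lborel) = 0"
          using sl by (subst nn_integral_0_iff_AE) (auto elim!: eventually_mono simp: ennreal_eq_0_iff)
        with m show ?thesis by simp
      qed
    qed
  qed
  also have "\<dots> = (\<integral>\<^sup>+ x. ennreal (f x) * \<phi> x \<partial>lborel_on (insert i I))"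
    using I by (subst lborel_family.product_nn_integral_insert) auto
  finally show ?thesis .
qed

end

text \<open>The interpolation \<open>k\<close> is a parameter, because the inequality is proved for families of coordinates
  and then used in a Euclidean space. Since \<open>0 powr s = 0\<close>, the weight vanishes where one of the
  densities does, which is a \<open>\<gamma>\<close>-null set. The same \<open>\<gamma>\<close> serves for all \<open>t\<close> and \<open>w\<close>.\<close>
definition displacement_coupling ::
    "'a measure \<Rightarrow> (real \<Rightarrow> 'a \<Rightarrow> 'a \<Rightarrow> 'a) \<Rightarrow> ('a \<Rightarrow> real) \<Rightarrow> ('a \<Rightarrow> real) \<Rightarrow> ('a \<times> 'a) measure \<Rightarrow> bool"
  where "displacement_coupling M k f g \<gamma> \<longleftrightarrow>
    sets \<gamma> = sets (M \<Otimes>\<^sub>M M) \<and> distr \<gamma> M fst = density M f \<and> distr \<gamma> M snd = density M g \<and>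
    (\<forall>t w. 0 < t \<longrightarrow> t < 1 \<longrightarrow> w \<in> borel_measurable M \<longrightarrow>
       (\<integral>\<^sup>+ z. w (k t (fst z) (snd z)) *
           ennreal (f (fst z) powr (- (1 - t)) * g (snd z) powr (- t)) \<partial>\<gamma>) \<le> (\<integral>\<^sup>+ x. w x \<partial>M))"

definition interpolate_on :: "'i set \<Rightarrow> real \<Rightarrow> ('i \<Rightarrow> real) \<Rightarrow> ('i \<Rightarrow> real) \<Rightarrow> 'i \<Rightarrow> real" where
  "interpolate_on I t x y = (\<lambda>j\<in>I. (1 - t) * x j + t * y j)"

lemma interpolate_on_insert:
  assumes "i \<notin> I"
  shows "interpolate_on (insert i I) t (x(i := a)) (y(i := b))
    = (interpolate_on I t x y)(i := (1 - t) * a + t * b)"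
  using assms by (auto simp: interpolate_on_def fun_eq_iff)

lemma measurable_interpolate_on:
  "(\<lambda>z. interpolate_on I t (fst z) (snd z)) \<in> measurable (lborel_on I \<Otimes>\<^sub>M lborel_on I) (lborel_on I)"
  unfolding interpolate_on_def
proof (rule measurable_restrict)
  fix j assume [measurable]: "j \<in> I"
  have [measurable]: "(\<lambda>x. x j) \<in> borel_measurable (lborel_on I)"
    using measurable_component_singleton[OF \<open>j \<in> I\<close>, of "\<lambda>_. lborel :: real measure"] by simp
  show "(\<lambda>z. (1 - t) * fst z j + t * snd z j) \<in> (lborel_on I \<Otimes>\<^sub>M lborel_on I) \<rightarrow>\<^sub>M lborel"
    by simp
qed

lemma displacement_couplingD:
  assumes "displacement_coupling M k f g \<gamma>"
  shows "sets \<gamma> = sets (M \<Otimes>\<^sub>M M)" "distr \<gamma> M fst = density M f" "distr \<gamma> M snd = density M g"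
    and "0 < t \<Longrightarrow> t < 1 \<Longrightarrow> w \<in> borel_measurable M \<Longrightarrow> (\<integral>\<^sup>+ z. w (k t (fst z) (snd z)) *
           ennreal (f (fst z) powr (- (1 - t)) * g (snd z) powr (- t)) \<partial>\<gamma>) \<le> (\<integral>\<^sup>+ x. w x \<partial>M)"
  using assms by (auto simp: displacement_coupling_def)

text \<open>The induction step of the Knothe construction. Given a pair of partial points from the coupling of the marginals,
  both last coordinates are produced from the same uniform variable by the conditional quantiles.
  The weight factorises into a marginal and a conditional part. The one-dimensional inequality
  integrates out the conditional part and replaces \<open>w\<close> by its integral over the new coordinate, to which the
  inequality for the marginals applies.\<close>
lemma displacement_coupling_insert:
  fixes I :: "'i set" and f g :: "('i \<Rightarrow> real) \<Rightarrow> real"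
  assumes I: "finite I" "i \<notin> I"
    and f: "prob_density (lborel_on (insert i I)) f" and g: "prob_density (lborel_on (insert i I)) g"
    and \<gamma>: "displacement_coupling (lborel_on I) (interpolate_on I) (marginal i f) (marginal i g) \<gamma>"
  shows "\<exists>\<gamma>'. displacement_coupling (lborel_on (insert i I)) (interpolate_on (insert i I)) f g \<gamma>'"
proof -
  let ?M = "lborel_on I" and ?M' = "lborel_on (insert i I)"
  note \<gamma>D = displacement_couplingD[OF \<gamma>]
  note [measurable_cong] = \<gamma>D(1)
  note [measurable] = joint_density_meas[OF I f] joint_density_meas[OF I g]
    marginal_meas[OF I f] marginal_meas[OF I g]
  define E where "E z = ((fst (fst z))(i := conditional_quantile i f (fst (fst z)) (snd z)),
    (snd (fst z))(i := conditional_quantile i g (snd (fst z)) (snd z)))" for z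
  have E1 [measurable]: "(\<lambda>z. (fst (fst z))(i := conditional_quantile i f (fst (fst z)) (snd z)))
      \<in> measurable (\<gamma> \<Otimes>\<^sub>M unit_uniform) ?M'"
    using measurable_compose[OF _ upd_quantile_meas[OF I f],
        of "\<lambda>z. (fst (fst z), snd z)" "\<gamma> \<Otimes>\<^sub>M unit_uniform"] by simp
  have E2 [measurable]: "(\<lambda>z. (snd (fst z))(i := conditional_quantile i g (snd (fst z)) (snd z)))
      \<in> measurable (\<gamma> \<Otimes>\<^sub>M unit_uniform) ?M'"
    using measurable_compose[OF _ upd_quantile_meas[OF I g],
        of "\<lambda>z. (snd (fst z), snd z)" "\<gamma> \<Otimes>\<^sub>M unit_uniform"] by simp
  have E [measurable]: "E \<in> measurable (\<gamma> \<Otimes>\<^sub>M unit_uniform) (?M' \<Otimes>\<^sub>M ?M')"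
    unfolding E_def by (intro measurable_Pair E1 E2)
  define \<gamma>' where "\<gamma>' = distr (\<gamma> \<Otimes>\<^sub>M unit_uniform) (?M' \<Otimes>\<^sub>M ?M') E"
  have [measurable_cong]: "sets \<gamma>' = sets (?M' \<Otimes>\<^sub>M ?M')"
    by (simp add: \<gamma>'_def)
  have int: "(\<integral>\<^sup>+ z. \<phi> z \<partial>\<gamma>') = (\<integral>\<^sup>+ z. (\<integral>\<^sup>+ u. \<phi> (E (z, u)) \<partial>unit_uniform) \<partial>\<gamma>)"
    if [measurable]: "\<phi> \<in> borel_measurable (?M' \<Otimes>\<^sub>M ?M')" for \<phi>
  proof -
    have "(\<integral>\<^sup>+ z. \<phi> z \<partial>\<gamma>') = (\<integral>\<^sup>+ z. \<phi> (E z) \<partial>(\<gamma> \<Otimes>\<^sub>M unit_uniform))"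
      unfolding \<gamma>'_def by (intro nn_integral_distr) auto
    also have "\<dots> = (\<integral>\<^sup>+ z. (\<integral>\<^sup>+ u. \<phi> (E (z, u)) \<partial>unit_uniform) \<partial>\<gamma>)"
      by (subst unit_uniform.nn_integral_fst[symmetric]) auto
    finally show ?thesis .
  qed
  have slice_f: "(\<lambda>x. \<integral>\<^sup>+ u. \<phi> (x(i := conditional_quantile i f x u)) \<partial>unit_uniform)
      \<in> borel_measurable ?M" if \<phi>: "\<phi> \<in> borel_measurable ?M'" for \<phi> :: "_ \<Rightarrow> ennreal"
    using measurable_compose[OF upd_quantile_meas[OF I f] \<phi>]
    by (intro unit_uniform.borel_measurable_nn_integral) (simp add: case_prod_beta')
  have slice_g: "(\<lambda>x. \<integral>\<^sup>+ u. \<phi> (x(i := conditional_quantile i g x u)) \<partial>unit_uniform)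
      \<in> borel_measurable ?M" if \<phi>: "\<phi> \<in> borel_measurable ?M'" for \<phi> :: "_ \<Rightarrow> ennreal"
    using measurable_compose[OF upd_quantile_meas[OF I g] \<phi>]
    by (intro unit_uniform.borel_measurable_nn_integral) (simp add: case_prod_beta')
  have eqI: "distr \<gamma>' ?M' r = density ?M' h"
    if r [measurable]: "r \<in> measurable (?M' \<Otimes>\<^sub>M ?M') ?M'" and h [measurable]: "h \<in> borel_measurable ?M'"
      and *: "\<And>\<phi>. \<phi> \<in> borel_measurable ?M' \<Longrightarrow>
        (\<integral>\<^sup>+ z. \<phi> (r z) \<partial>\<gamma>') = (\<integral>\<^sup>+ x. h x * \<phi> x \<partial>?M')" for r h
  proof (rule measure_eqI)
    fix A assume "A \<in> sets (distr \<gamma>' ?M' r)"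
    then have A [measurable]: "A \<in> sets ?M'" by simp
    have "emeasure (distr \<gamma>' ?M' r) A = (\<integral>\<^sup>+ x. indicator A x \<partial>distr \<gamma>' ?M' r)"
      by simp
    also have "\<dots> = (\<integral>\<^sup>+ z. indicator A (r z) \<partial>\<gamma>')"
      by (rule nn_integral_distr) auto
    also have "\<dots> = (\<integral>\<^sup>+ x. h x * indicator A x \<partial>?M')"
      by (rule *) simp
    also have "\<dots> = emeasure (density ?M' h) A"
      by (simp add: emeasure_density)
    finally show "emeasure (distr \<gamma>' ?M' r) A = emeasure (density ?M' h) A" .
  qed simp
  have d1: "distr \<gamma>' ?M' fst = density ?M' f"
  proof (rule eqI)
    fix \<phi> :: "('i \<Rightarrow> real) \<Rightarrow> ennreal" assume \<phi> [measurable]: "\<phi> \<in> borel_measurable ?M'"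
    have "(\<integral>\<^sup>+ z. \<phi> (fst z) \<partial>\<gamma>')
        = (\<integral>\<^sup>+ z. (\<integral>\<^sup>+ u. \<phi> ((fst z)(i := conditional_quantile i f (fst z) u)) \<partial>unit_uniform) \<partial>\<gamma>)"
      by (subst int) (auto simp: E_def)
    also have "\<dots> = (\<integral>\<^sup>+ x. (\<integral>\<^sup>+ u. \<phi> (x(i := conditional_quantile i f x u)) \<partial>unit_uniform)
        \<partial>distr \<gamma> ?M fst)"
      by (subst nn_integral_distr) (auto intro: slice_f)
    also have "\<dots> = (\<integral>\<^sup>+ x. ennreal (f x) * \<phi> x \<partial>?M')"
      unfolding \<gamma>D(2) by (rule nn_integral_upd_quantile[OF I f \<phi>])
    finally show "(\<integral>\<^sup>+ z. \<phi> (fst z) \<partial>\<gamma>') = (\<integral>\<^sup>+ x. ennreal (f x) * \<phi> x \<partial>?M')" .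
  qed auto
  have d2: "distr \<gamma>' ?M' snd = density ?M' g"
  proof (rule eqI)
    fix \<phi> :: "('i \<Rightarrow> real) \<Rightarrow> ennreal" assume \<phi> [measurable]: "\<phi> \<in> borel_measurable ?M'"
    have "(\<integral>\<^sup>+ z. \<phi> (snd z) \<partial>\<gamma>')
        = (\<integral>\<^sup>+ z. (\<integral>\<^sup>+ u. \<phi> ((snd z)(i := conditional_quantile i g (snd z) u)) \<partial>unit_uniform) \<partial>\<gamma>)"
      by (subst int) (auto simp: E_def)
    also have "\<dots> = (\<integral>\<^sup>+ x. (\<integral>\<^sup>+ u. \<phi> (x(i := conditional_quantile i g x u)) \<partial>unit_uniform)
        \<partial>distr \<gamma> ?M snd)"
      by (subst nn_integral_distr) (auto intro: slice_g)
    also have "\<dots> = (\<integral>\<^sup>+ x. ennreal (g x) * \<phi> x \<partial>?M')"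
      unfolding \<gamma>D(3) by (rule nn_integral_upd_quantile[OF I g \<phi>])
    finally show "(\<integral>\<^sup>+ z. \<phi> (snd z) \<partial>\<gamma>') = (\<integral>\<^sup>+ x. ennreal (g x) * \<phi> x \<partial>?M')" .
  qed auto
  have AE_f: "AE z in \<gamma>. \<forall>s. f ((fst z)(i := s)) = marginal i f (fst z) * conditional i f (fst z) s"
  proof (rule AE_distrD[where f = fst])
    show "fst \<in> measurable \<gamma> ?M" by simp
    show "AE x in distr \<gamma> ?M fst. \<forall>s. f (x(i := s)) = marginal i f x * conditional i f x s"
      unfolding \<gamma>D(2) by (rule AE_density_marginal[OF I f])
  qed
  have AE_g: "AE z in \<gamma>. \<forall>s. g ((snd z)(i := s)) = marginal i g (snd z) * conditional i g (snd z) s"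
  proof (rule AE_distrD[where f = snd])
    show "snd \<in> measurable \<gamma> ?M" by simp
    show "AE x in distr \<gamma> ?M snd. \<forall>s. g (x(i := s)) = marginal i g x * conditional i g x s"
      unfolding \<gamma>D(3) by (rule AE_density_marginal[OF I g])
  qed
  have bound: "(\<integral>\<^sup>+ z. w (interpolate_on (insert i I) t (fst z) (snd z)) *
        ennreal (f (fst z) powr (- (1 - t)) * g (snd z) powr (- t)) \<partial>\<gamma>') \<le> (\<integral>\<^sup>+ x. w x \<partial>?M')"
    if t: "0 < t" "t < 1" and w [measurable]: "w \<in> borel_measurable ?M'" for t w
  proof -
    note [measurable] = measurable_interpolate_on
    define w1 where "w1 x = (\<integral>\<^sup>+ s. w (x(i := s)) \<partial>lborel)" for x
    have w_upd: "(\<lambda>z. w ((fst z)(i := snd z))) \<in> borel_measurable (?M \<Otimes>\<^sub>M borel)"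
      using measurable_compose[OF coordinate_upd_meas[OF I f] w] by (simp add: case_prod_beta')
    then have w1 [measurable]: "w1 \<in> borel_measurable ?M"
      unfolding w1_def by (intro lborel.borel_measurable_nn_integral) (simp add: case_prod_beta')
    have "(\<integral>\<^sup>+ z. w (interpolate_on (insert i I) t (fst z) (snd z)) *
        ennreal (f (fst z) powr (- (1 - t)) * g (snd z) powr (- t)) \<partial>\<gamma>')
      = (\<integral>\<^sup>+ z. (\<integral>\<^sup>+ u. w (interpolate_on (insert i I) t (fst (E (z, u))) (snd (E (z, u)))) *
          ennreal (f (fst (E (z, u))) powr (- (1 - t)) * g (snd (E (z, u))) powr (- t))
          \<partial>unit_uniform) \<partial>\<gamma>)"
      by (rule int) measurable
    also have "\<dots> \<le> (\<integral>\<^sup>+ z. w1 (interpolate_on I t (fst z) (snd z)) *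
        ennreal (marginal i f (fst z) powr (- (1 - t)) * marginal i g (snd z) powr (- t)) \<partial>\<gamma>)"
    proof (rule nn_integral_mono_AE)
      show "AE z in \<gamma>. (\<integral>\<^sup>+ u. w (interpolate_on (insert i I) t (fst (E (z, u))) (snd (E (z, u)))) *
          ennreal (f (fst (E (z, u))) powr (- (1 - t)) * g (snd (E (z, u))) powr (- t))
          \<partial>unit_uniform)
        \<le> w1 (interpolate_on I t (fst z) (snd z)) *
          ennreal (marginal i f (fst z) powr (- (1 - t)) * marginal i g (snd z) powr (- t))"
        using AE_f AE_g AE_space
      proof eventually_elim
        case (elim z)
        define x y where "x = fst z" and "y = snd z"
        have xy: "x \<in> space ?M" "y \<in> space ?M"
        proof -
          have "z \<in> space (?M \<Otimes>\<^sub>M ?M)"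
            using elim(3) by (subst sets_eq_imp_space_eq[OF \<gamma>D(1), symmetric])
          then show "x \<in> space ?M" "y \<in> space ?M"
            unfolding x_def y_def space_pair_measure by (simp_all only: mem_Times_iff)
        qed
        define c where "c = interpolate_on I t x y"
        have c: "c \<in> space ?M"
          using measurable_space[OF measurable_interpolate_on, of "(x, y)" I t] xy
          by (simp add: c_def space_pair_measure)
        define P Q where "P = conditional_quantile i f x" and "Q = conditional_quantile i g y"
        let ?C = "ennreal (marginal i f x powr (- (1 - t)) * marginal i g y powr (- t))"
        note cq = conditional_quantile_slice[OF I f xy(1)] conditional_quantile_slice[OF I g xy(2)]
        note [measurable] = conditional_slice_meas[OF I f xy(1)] conditional_slice_meas[OF I g xy(2)]
        have wc [measurable]: "(\<lambda>s. w (c(i := s))) \<in> borel_measurable borel"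
          using measurable_Pair2[OF w_upd c] by simp
        have [measurable]: "P \<in> borel_measurable unit_uniform" "Q \<in> borel_measurable unit_uniform"
          using cq by (simp_all add: P_def Q_def)
        have nn: "0 \<le> marginal i f x" "0 \<le> marginal i g y"
          by (simp_all add: marginal_def)
        have "(\<integral>\<^sup>+ u. w (interpolate_on (insert i I) t (fst (E (z, u))) (snd (E (z, u)))) *
            ennreal (f (fst (E (z, u))) powr (- (1 - t)) * g (snd (E (z, u))) powr (- t))
            \<partial>unit_uniform)
          = (\<integral>\<^sup>+ u. (w (c(i := (1 - t) * P u + t * Q u)) *
            ennreal (conditional i f x (P u) powr (- (1 - t)) * conditional i g y (Q u) powr (- t))) * ?C
            \<partial>unit_uniform)"
        proof (rule nn_integral_cong)
          fix u
          have "f (x(i := P u)) = marginal i f x * conditional i f x (P u)"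
            "g (y(i := Q u)) = marginal i g y * conditional i g y (Q u)"
            using elim by (simp_all add: x_def y_def)
          then have "f (x(i := P u)) powr (- (1 - t)) * g (y(i := Q u)) powr (- t)
            = (conditional i f x (P u) powr (- (1 - t)) * conditional i g y (Q u) powr (- t))
              * (marginal i f x powr (- (1 - t)) * marginal i g y powr (- t))"
            using nn conditional_nonneg[OF I f] conditional_nonneg[OF I g] by (simp add: powr_mult)
          then have "ennreal (f (x(i := P u)) powr (- (1 - t)) * g (y(i := Q u)) powr (- t))
            = ennreal (conditional i f x (P u) powr (- (1 - t)) * conditional i g y (Q u) powr (- t)) * ?C"
            by (simp add: ennreal_mult')
          then show "w (interpolate_on (insert i I) t (fst (E (z, u))) (snd (E (z, u)))) *
              ennreal (f (fst (E (z, u))) powr (- (1 - t)) * g (snd (E (z, u))) powr (- t))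
            = (w (c(i := (1 - t) * P u + t * Q u)) *
            ennreal (conditional i f x (P u) powr (- (1 - t)) * conditional i g y (Q u) powr (- t))) * ?C"
            using interpolate_on_insert[OF I(2)]
            by (simp add: E_def c_def P_def Q_def x_def y_def mult.assoc)
        qed
        also have "\<dots> = (\<integral>\<^sup>+ u. w (c(i := (1 - t) * P u + t * Q u)) *
            ennreal (conditional i f x (P u) powr (- (1 - t)) * conditional i g y (Q u) powr (- t))
            \<partial>unit_uniform) * ?C"
          by (rule nn_integral_multc) measurable
        also have "\<dots> \<le> w1 c * ?C"
          unfolding w1_def P_def Q_def using t cq
          by (intro mult_right_mono quantile_interpolation conditional_nonneg[OF I f]
              conditional_nonneg[OF I g]) auto
        finally show ?case
          by (simp add: c_def x_def y_def)
      qed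
    qed
    also have "\<dots> \<le> (\<integral>\<^sup>+ x. w1 x \<partial>?M)"
      using t w1 by (rule \<gamma>D(4))
    also have "\<dots> = (\<integral>\<^sup>+ x. w x \<partial>?M')"
      unfolding w1_def using I by (subst lborel_family.product_nn_integral_insert) auto
    finally show ?thesis .
  qed
  show ?thesis
    unfolding displacement_coupling_def
    by (intro exI[of _ \<gamma>'] conjI allI impI d1 d2 bound) (auto simp: \<gamma>'_def)
qed

theorem ex_displacement_coupling_PiM:
  fixes I :: "'i set"
  assumes "finite I" and "prob_density (lborel_on I) f" and "prob_density (lborel_on I) g"
  shows "\<exists>\<gamma>. displacement_coupling (lborel_on I) (interpolate_on I) f g \<gamma>"
  using assms
proof (induction I arbitrary: f g rule: finite_induct)
  case empty
  let ?M = "lborel_on ({} :: 'i set)" and ?e = "\<lambda>_::'i. undefined :: real"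
  have M: "?M = count_space {?e}" by (rule PiM_empty)
  have e: "(?e, ?e) \<in> space (?M \<Otimes>\<^sub>M ?M)" by (simp add: space_pair_measure M)
  have f1: "f ?e = 1" and g1: "g ?e = 1"
    using empty by (auto simp: prob_density_def M nn_integral_count_space_finite)
  have ret: "return ?M ?e = density ?M (\<lambda>x. ennreal (h x))" if "h ?e = 1" for h :: "('i \<Rightarrow> real) \<Rightarrow> real"
    unfolding M using that
    by (intro measure_eqI) (auto simp: emeasure_density nn_integral_count_space_finite)
  have "distr (return (?M \<Otimes>\<^sub>M ?M) (?e, ?e)) ?M fst = density ?M f"
    "distr (return (?M \<Otimes>\<^sub>M ?M) (?e, ?e)) ?M snd = density ?M g"
    using e ret[of f] ret[of g] f1 g1 by (simp_all add: distr_return)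
  moreover have "(\<integral>\<^sup>+ z. w (interpolate_on {} t (fst z) (snd z)) *
      ennreal (f (fst z) powr (- (1 - t)) * g (snd z) powr (- t))
      \<partial>return (?M \<Otimes>\<^sub>M ?M) (?e, ?e)) \<le> (\<integral>\<^sup>+ x. w x \<partial>?M)" for t w
  proof -
    have "(\<lambda>z. w (interpolate_on {} t (fst z) (snd z)) *
      ennreal (f (fst z) powr (- (1 - t)) * g (snd z) powr (- t))) \<in> borel_measurable (?M \<Otimes>\<^sub>M ?M)"
      unfolding M by (simp add: pair_measure_countable)
    from nn_integral_return[OF e this] show ?thesis
      unfolding lborel_family.nn_integral_empty[OF zero_le] by (simp add: f1 g1 interpolate_on_def restrict_def)
  qed
  ultimately show ?case
    unfolding displacement_coupling_def by (intro exI[of _ "return (?M \<Otimes>\<^sub>M ?M) (?e, ?e)"]) auto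
next
  case (insert i I)
  note dens = prob_density_marginal[OF insert.hyps]
  from insert.IH[OF dens dens, OF insert.prems] obtain \<gamma> where
    "displacement_coupling (lborel_on I) (interpolate_on I) (marginal i f) (marginal i g) \<gamma>"
    by blast
  with insert show ?case
    by (intro displacement_coupling_insert)
qed

text \<open>Transfer along the linear isomorphism \<open>e\<close> between coordinate families and vectors, which preserves
  Lebesgue measure and interpolation.\<close>
theorem ex_displacement_coupling:
  fixes f g :: "'a::euclidean_space \<Rightarrow> real"
  assumes f: "prob_density lborel f" and g: "prob_density lborel g"
  shows "\<exists>\<gamma>. displacement_coupling lborel (\<lambda>t x y. (1 - t) *\<^sub>R x + t *\<^sub>R y) f g \<gamma>"
proof -
  let ?M = "lborel_on (Basis :: 'a set)"
  define e where "e x = (\<Sum>b\<in>Basis. x b *\<^sub>R b)" for x :: "'a \<Rightarrow> real"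
  have e [measurable]: "e \<in> borel_measurable ?M"
    unfolding e_def
  proof (rule borel_measurable_sum)
    fix b :: 'a assume "b \<in> Basis"
    from measurable_component_singleton[OF this, of "\<lambda>_. lborel :: real measure"]
    have [measurable]: "(\<lambda>x. x b) \<in> borel_measurable ?M" by simp
    show "(\<lambda>x. x b *\<^sub>R b) \<in> borel_measurable ?M" by measurable
  qed
  have lb: "lborel = distr ?M borel e"
    unfolding e_def[abs_def] by (rule lborel_eq)
  have int: "(\<integral>\<^sup>+ x. w x \<partial>lborel) = (\<integral>\<^sup>+ x. w (e x) \<partial>?M)" if "w \<in> borel_measurable borel" for w
    using that by (subst lb) (simp add: nn_integral_distr)
  have dens: "prob_density ?M (\<lambda>x. h (e x))" if "prob_density lborel h" for h
  proof -
    have [measurable]: "h \<in> borel_measurable borel"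
      using that by (simp add: prob_density_def)
    have "(\<lambda>x. h (e x)) \<in> borel_measurable ?M"
      by measurable
    then show ?thesis
      using that int[of "\<lambda>x. ennreal (h x)"] by (simp add: prob_density_def)
  qed
  have [measurable]: "f \<in> borel_measurable borel" "g \<in> borel_measurable borel"
    using f g by (auto simp: prob_density_def)
  obtain \<gamma> where \<gamma>: "displacement_coupling ?M (interpolate_on Basis) (\<lambda>x. f (e x)) (\<lambda>x. g (e x)) \<gamma>"
    using ex_displacement_coupling_PiM[OF finite_Basis dens[OF f] dens[OF g]] by blast
  note \<gamma>D = displacement_couplingD[OF \<gamma>]
  note [measurable_cong] = \<gamma>D(1)
  define E where "E z = (e (fst z), e (snd z))" for z
  have [measurable]: "E \<in> measurable \<gamma> (borel \<Otimes>\<^sub>M borel)"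
    unfolding E_def by measurable
  define \<gamma>' where "\<gamma>' = distr \<gamma> (lborel \<Otimes>\<^sub>M lborel) E"
  have push: "distr (density ?M (\<lambda>x. ennreal (h (e x)))) lborel e = density lborel (\<lambda>x. ennreal (h x))"
    if [measurable]: "h \<in> borel_measurable borel" for h
    using density_distr[of "\<lambda>x. ennreal (h x)" borel e ?M] lb
    by (simp cong: distr_cong)
  have "distr \<gamma>' lborel fst = distr (distr \<gamma> ?M fst) lborel e"
    by (simp add: \<gamma>'_def distr_distr comp_def E_def)
  then have d1: "distr \<gamma>' lborel fst = density lborel f"
    by (simp add: \<gamma>D(2) push)
  have "distr \<gamma>' lborel snd = distr (distr \<gamma> ?M snd) lborel e"
    by (simp add: \<gamma>'_def distr_distr comp_def E_def)
  then have d2: "distr \<gamma>' lborel snd = density lborel g"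
    by (simp add: \<gamma>D(3) push)
  have e_int: "e (interpolate_on Basis t x y) = (1 - t) *\<^sub>R e x + t *\<^sub>R e y" for t x y
    by (simp add: e_def interpolate_on_def scaleR_sum_right scaleR_add_left sum.distrib)
  have bound: "(\<integral>\<^sup>+ z. w ((1 - t) *\<^sub>R fst z + t *\<^sub>R snd z) *
      ennreal (f (fst z) powr (- (1 - t)) * g (snd z) powr (- t)) \<partial>\<gamma>') \<le> (\<integral>\<^sup>+ x. w x \<partial>lborel)"
    if t: "0 < t" "t < 1" and w: "w \<in> borel_measurable lborel" for t w
  proof -
    have [measurable]: "w \<in> borel_measurable borel" using w by simp
    have "(\<integral>\<^sup>+ z. w ((1 - t) *\<^sub>R fst z + t *\<^sub>R snd z) *
      ennreal (f (fst z) powr (- (1 - t)) * g (snd z) powr (- t)) \<partial>\<gamma>')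
      = (\<integral>\<^sup>+ z. w (e (interpolate_on Basis t (fst z) (snd z))) *
      ennreal (f (e (fst z)) powr (- (1 - t)) * g (e (snd z)) powr (- t)) \<partial>\<gamma>)"
      unfolding \<gamma>'_def e_int by (subst nn_integral_distr) (simp_all add: E_def)
    also have "\<dots> \<le> (\<integral>\<^sup>+ x. w (e x) \<partial>?M)"
      using t by (intro \<gamma>D(4)) auto
    finally show ?thesis
      by (simp add: int)
  qed
  show ?thesis
    unfolding displacement_coupling_def
    by (intro exI[of _ \<gamma>'] conjI allI impI d1 d2 bound) (auto simp: \<gamma>'_def)
qed

section \<open>Tilts of strongly log-concave measures\<close>

text \<open>The constant may be negative, as it is for the prior when \<open>\<lambda> < 0\<close>.\<close>
definition strongly_convex_on :: "'a::euclidean_space set \<Rightarrow> real \<Rightarrow> ('a \<Rightarrow> real) \<Rightarrow> bool" where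
  "strongly_convex_on S c U \<longleftrightarrow> convex S \<and>
     (\<forall>x\<in>S. \<forall>y\<in>S. \<forall>t. 0 < t \<longrightarrow> t < 1 \<longrightarrow>
        U ((1 - t) *\<^sub>R x + t *\<^sub>R y) \<le> (1 - t) * U x + t * U y - c / 2 * (dist x y)\<^sup>2 * t * (1 - t))"

text \<open>Jensen's inequality for the exponential function, from \<open>1 + s \<le> exp s\<close>.\<close>
lemma integral_nonpos_of_exp:
  assumes "prob_space M" and A: "integrable M A" and le: "(\<integral>\<^sup>+ z. ennreal (exp (A z)) \<partial>M) \<le> 1"
  shows "(\<integral>z. A z \<partial>M) \<le> (0 :: real)"
proof -
  interpret prob_space M by fact
  have [measurable]: "A \<in> borel_measurable M" using A by simp
  have e: "integrable M (\<lambda>z. exp (A z))"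
    using le by (intro integrableI_bounded) (auto simp: top_unique less_top[symmetric])
  have "(\<integral>z. 1 + A z \<partial>M) \<le> (\<integral>z. exp (A z) \<partial>M)"
    using A e by (intro integral_mono) (auto simp: exp_ge_add_one_self)
  also have "\<dots> \<le> 1"
    using le e by (simp add: nn_integral_eq_integral)
  finally show ?thesis
    using A by (simp add: prob_space)
qed

text \<open>The logarithms of the integrands of the displacement inequality with \<open>w\<close> the first and the second
  density. Here \<open>K\<close> is \<open>\<kappa> / 2\<close> times the squared distance of \<open>x\<close> and \<open>y\<close>, while \<open>ca\<close> and \<open>cb\<close> are the log-normalisers.
  The linear terms of the first density cancel in the interpolation, so that only its difference to
  the second one remains, with a factor \<open>t\<close>; by symmetry the factor is \<open>1 - t\<close> in the second case.\<close>
lemma log_interpolation_bound: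
  fixes a b v :: "'a::real_inner"
  assumes "Uz \<le> (1 - t) * Ux + t * Uy - K * t * (1 - t)" and z: "z = (1 - t) *\<^sub>R x + t *\<^sub>R y"
  shows "exp (t * ((1 - t) * K + (a - b) \<bullet> y + (cb - ca)))
      \<le> exp (a \<bullet> z - Uz - ca) *
        (exp (a \<bullet> x - Ux - ca) powr (- (1 - t)) * exp (b \<bullet> y - Uy - cb) powr (- t))"
    and "exp ((1 - t) * (t * K + (b - a) \<bullet> x + (ca - cb)))
      \<le> exp (b \<bullet> z - Uz - cb) *
        (exp (a \<bullet> x - Ux - ca) powr (- (1 - t)) * exp (b \<bullet> y - Uy - cb) powr (- t))"
proof -
  have "t * ((1 - t) * K + (a - b) \<bullet> y + (cb - ca))
      \<le> a \<bullet> z - Uz - ca + (- (1 - t) * (a \<bullet> x - Ux - ca) + - t * (b \<bullet> y - Uy - cb))"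
    using assms(1) unfolding z by (simp add: inner_add_right inner_diff_left algebra_simps)
  then show "exp (t * ((1 - t) * K + (a - b) \<bullet> y + (cb - ca)))
      \<le> exp (a \<bullet> z - Uz - ca) *
        (exp (a \<bullet> x - Ux - ca) powr (- (1 - t)) * exp (b \<bullet> y - Uy - cb) powr (- t))"
    by (simp only: powr_def exp_not_eq_zero if_False ln_exp flip: exp_add) simp
  have "(1 - t) * (t * K + (b - a) \<bullet> x + (ca - cb))
      \<le> b \<bullet> z - Uz - cb + (- (1 - t) * (a \<bullet> x - Ux - ca) + - t * (b \<bullet> y - Uy - cb))"
    using assms(1) unfolding z by (simp add: inner_add_right inner_diff_left algebra_simps)
  then show "exp ((1 - t) * (t * K + (b - a) \<bullet> x + (ca - cb)))
      \<le> exp (b \<bullet> z - Uz - cb) *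
        (exp (a \<bullet> x - Ux - ca) powr (- (1 - t)) * exp (b \<bullet> y - Uy - cb) powr (- t))"
    by (simp only: powr_def exp_not_eq_zero if_False ln_exp flip: exp_add) simp
qed

text \<open>Second moments are finite, so all terms of the two exponents are integrable, and the limits
  \<open>t \<rightarrow> 0\<close> and \<open>t \<rightarrow> 1\<close> can be taken in numerical inequalities that are affine in \<open>t\<close>.\<close>
theorem wasserstein2_tilted_le:
  fixes S :: "'a::euclidean_space set" and a b :: 'a
  assumes \<kappa>: "0 < \<kappa>" and U: "strongly_convex_on S \<kappa> U"
    and f: "prob_density lborel f" and g: "prob_density lborel g"
    and f_def: "\<And>x. f x = indicator S x * exp (a \<bullet> x - U x - ca)"
    and g_def: "\<And>x. g x = indicator S x * exp (b \<bullet> x - U x - cb)"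
    and f2: "(\<integral>\<^sup>+ x. ennreal ((norm x)\<^sup>2 * f x) \<partial>lborel) < \<infinity>"
    and g2: "(\<integral>\<^sup>+ x. ennreal ((norm x)\<^sup>2 * g x) \<partial>lborel) < \<infinity>"
  shows "wasserstein2 (density lborel f) (density lborel g) \<le> ennreal (norm (a - b) / \<kappa>)"
proof -
  have [measurable]: "f \<in> borel_measurable borel" "g \<in> borel_measurable borel"
    and f0: "\<And>x. 0 \<le> f x" and g0: "\<And>x. 0 \<le> g x"
    and f1: "(\<integral>\<^sup>+ x. ennreal (f x) \<partial>lborel) = 1" and g1: "(\<integral>\<^sup>+ x. ennreal (g x) \<partial>lborel) = 1"
    using f g by (auto simp: prob_density_def)
  obtain \<gamma> where "displacement_coupling lborel (\<lambda>t x y. (1 - t) *\<^sub>R x + t *\<^sub>R y) f g \<gamma>"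
    using ex_displacement_coupling[OF f g] by blast
  note \<gamma>D = displacement_couplingD[OF this]
  have sets_\<gamma> [measurable_cong]: "sets \<gamma> = sets (borel \<Otimes>\<^sub>M borel)"
    using \<gamma>D(1) by (simp cong: sets_pair_measure_cong)
  have d1: "distr \<gamma> borel fst = density lborel f" and d2: "distr \<gamma> borel snd = density lborel g"
    using \<gamma>D(2,3) by (simp_all cong: distr_cong)
  have "prob_space (distr \<gamma> borel fst)"
    unfolding d1 by (rule prob_spaceI) (simp add: emeasure_density f1)
  then interpret \<gamma>: prob_space \<gamma>
    by (rule prob_space_distrD[rotated]) simp
  have fS: "f x \<noteq> 0 \<Longrightarrow> x \<in> S" and gS: "g x \<noteq> 0 \<Longrightarrow> x \<in> S" for x
    by (auto simp: f_def g_def indicator_def split: if_splits)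
  have "AE x in density lborel f. x \<in> S" "AE x in density lborel g. x \<in> S"
    by (subst AE_density; use fS gS in force)+
  then have S: "AE z in \<gamma>. fst z \<in> S" "AE z in \<gamma>. snd z \<in> S"
    unfolding d1[symmetric] d2[symmetric] by (auto dest!: AE_distrD[rotated])
  have x2: "integrable \<gamma> (\<lambda>z. (norm (fst z))\<^sup>2)"
  proof (rule integrableI_bounded)
    have "(\<integral>\<^sup>+ z. ennreal (norm ((norm (fst z))\<^sup>2)) \<partial>\<gamma>) = (\<integral>\<^sup>+ x. ennreal ((norm x)\<^sup>2) \<partial>distr \<gamma> borel fst)"
      by (subst nn_integral_distr) auto
    also have "\<dots> = (\<integral>\<^sup>+ x. ennreal ((norm x)\<^sup>2 * f x) \<partial>lborel)"
      unfolding d1 using f0 by (subst nn_integral_density) (auto simp: ennreal_mult' mult.commute)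
    finally show "(\<integral>\<^sup>+ z. ennreal (norm ((norm (fst z))\<^sup>2)) \<partial>\<gamma>) < \<infinity>"
      using f2 by simp
  qed simp
  have y2: "integrable \<gamma> (\<lambda>z. (norm (snd z))\<^sup>2)"
  proof (rule integrableI_bounded)
    have "(\<integral>\<^sup>+ z. ennreal (norm ((norm (snd z))\<^sup>2)) \<partial>\<gamma>) = (\<integral>\<^sup>+ x. ennreal ((norm x)\<^sup>2) \<partial>distr \<gamma> borel snd)"
      by (subst nn_integral_distr) auto
    also have "\<dots> = (\<integral>\<^sup>+ x. ennreal ((norm x)\<^sup>2 * g x) \<partial>lborel)"
      unfolding d2 using g0 by (subst nn_integral_density) (auto simp: ennreal_mult' mult.commute)
    finally show "(\<integral>\<^sup>+ z. ennreal (norm ((norm (snd z))\<^sup>2)) \<partial>\<gamma>) < \<infinity>"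
      using g2 by simp
  qed simp
  have lin: "\<bar>v \<bullet> p\<bar> \<le> norm v * (1 + (norm p)\<^sup>2)" for v p :: 'a
  proof -
    have "norm p \<le> 1 + (norm p)\<^sup>2"
      using zero_le_power2[of "norm p - 1"] norm_ge_zero[of p] unfolding power2_diff power_one mult_1_right by linarith
    then show ?thesis
      using Cauchy_Schwarz_ineq2[of v p] by (meson mult_left_mono norm_ge_zero order_trans)
  qed
  have xv: "integrable \<gamma> (\<lambda>z. v \<bullet> fst z)" and yv: "integrable \<gamma> (\<lambda>z. v \<bullet> snd z)" for v
    using x2 y2 lin[of v]
    by (auto intro!: Bochner_Integration.integrable_bound[where g = "\<lambda>z. v \<bullet> fst z" and
        f = "\<lambda>z. norm v * (1 + (norm (fst z))\<^sup>2)"]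
        Bochner_Integration.integrable_bound[where g = "\<lambda>z. v \<bullet> snd z" and
        f = "\<lambda>z. norm v * (1 + (norm (snd z))\<^sup>2)"])
  have d2i: "integrable \<gamma> (\<lambda>z. (dist (fst z) (snd z))\<^sup>2)"
  proof (rule Bochner_Integration.integrable_bound)
    show "integrable \<gamma> (\<lambda>z. 2 * (norm (fst z))\<^sup>2 + 2 * (norm (snd z))\<^sup>2)"
      using x2 y2 by auto
    have "(dist p q)\<^sup>2 \<le> 2 * (norm p)\<^sup>2 + 2 * (norm q)\<^sup>2" for p q :: 'a
      using inner_ge_zero[of "p + q"]
      by (simp add: dist_norm power2_norm_eq_inner inner_add inner_diff inner_commute)
    then show "AE z in \<gamma>. norm ((dist (fst z) (snd z))\<^sup>2) \<le> norm (2 * (norm (fst z))\<^sup>2 + 2 * (norm (snd z))\<^sup>2)"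
      by simp
  qed simp
  define D where "D = (\<integral>z. (dist (fst z) (snd z))\<^sup>2 \<partial>\<gamma>)"
  define ex ey where "ex = (\<integral>z. (b - a) \<bullet> fst z \<partial>\<gamma>)" and "ey = (\<integral>z. (a - b) \<bullet> snd z \<partial>\<gamma>)"
  have U_le: "U ((1 - t) *\<^sub>R x + t *\<^sub>R y) \<le> (1 - t) * U x + t * U y - \<kappa> / 2 * (dist x y)\<^sup>2 * t * (1 - t)"
    and S_int: "(1 - t) *\<^sub>R x + t *\<^sub>R y \<in> S"
    if "x \<in> S" "y \<in> S" "0 < t" "t < 1" for x y t
    using U that by (simp_all add: strongly_convex_on_def convex_alt)
  have first: "(1 - t) * (\<kappa> / 2 * D) \<le> - ey - (cb - ca)" if t: "0 < t" "t < 1" for t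
  proof -
    let ?A = "\<lambda>z. t * ((1 - t) * (\<kappa> / 2 * (dist (fst z) (snd z))\<^sup>2) + (a - b) \<bullet> snd z + (cb - ca))"
    have "(\<integral>\<^sup>+ z. ennreal (exp (?A z)) \<partial>\<gamma>) \<le> (\<integral>\<^sup>+ z. ennreal (f ((1 - t) *\<^sub>R fst z + t *\<^sub>R snd z)) *
      ennreal (f (fst z) powr (- (1 - t)) * g (snd z) powr (- t)) \<partial>\<gamma>)"
    proof (rule nn_integral_mono_AE)
      show "AE z in \<gamma>. ennreal (exp (?A z)) \<le> ennreal (f ((1 - t) *\<^sub>R fst z + t *\<^sub>R snd z)) *
        ennreal (f (fst z) powr (- (1 - t)) * g (snd z) powr (- t))"
        using S
      proof eventually_elim
        case (elim z)
        show ?case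
          using log_interpolation_bound(1)[OF U_le[OF elim t] refl, where a = a and b = b and ca = ca and cb = cb] elim t S_int[OF elim t]
          by (simp add: f_def g_def flip: ennreal_mult')
      qed
    qed
    also have "\<dots> \<le> 1"
      using \<gamma>D(4)[OF t, of "\<lambda>x. ennreal (f x)"] f1 by simp
    finally have "(\<integral>z. ?A z \<partial>\<gamma>) \<le> 0"
      using d2i yv by (intro integral_nonpos_of_exp \<gamma>.prob_space_axioms) auto
    also have "(\<integral>z. ?A z \<partial>\<gamma>) = t * ((1 - t) * (\<kappa> / 2 * D) + ey + (cb - ca))"
      using d2i yv by (simp add: D_def ey_def \<gamma>.prob_space)
    finally show ?thesis
      using t by (simp add: mult_le_0_iff)
  qed
  have second: "t * (\<kappa> / 2 * D) \<le> - ex - (ca - cb)" if t: "0 < t" "t < 1" for t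
  proof -
    let ?A = "\<lambda>z. (1 - t) * (t * (\<kappa> / 2 * (dist (fst z) (snd z))\<^sup>2) + (b - a) \<bullet> fst z + (ca - cb))"
    have "(\<integral>\<^sup>+ z. ennreal (exp (?A z)) \<partial>\<gamma>) \<le> (\<integral>\<^sup>+ z. ennreal (g ((1 - t) *\<^sub>R fst z + t *\<^sub>R snd z)) *
      ennreal (f (fst z) powr (- (1 - t)) * g (snd z) powr (- t)) \<partial>\<gamma>)"
    proof (rule nn_integral_mono_AE)
      show "AE z in \<gamma>. ennreal (exp (?A z)) \<le> ennreal (g ((1 - t) *\<^sub>R fst z + t *\<^sub>R snd z)) *
        ennreal (f (fst z) powr (- (1 - t)) * g (snd z) powr (- t))"
        using S
      proof eventually_elim
        case (elim z)
        show ?case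
          using log_interpolation_bound(2)[OF U_le[OF elim t] refl, where a = a and b = b and ca = ca and cb = cb] elim t S_int[OF elim t]
          by (simp add: f_def g_def flip: ennreal_mult')
      qed
    qed
    also have "\<dots> \<le> 1"
      using \<gamma>D(4)[OF t, of "\<lambda>x. ennreal (g x)"] g1 by simp
    finally have "(\<integral>z. ?A z \<partial>\<gamma>) \<le> 0"
      using d2i xv by (intro integral_nonpos_of_exp \<gamma>.prob_space_axioms) auto
    also have "(\<integral>z. ?A z \<partial>\<gamma>) = (1 - t) * (t * (\<kappa> / 2 * D) + ex + (ca - cb))"
      using d2i xv by (simp add: D_def ex_def \<gamma>.prob_space)
    finally show ?thesis
      using t by (simp add: mult_le_0_iff)
  qed
  have "\<kappa> / 2 * D \<le> - ey - (cb - ca)"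
  proof (rule field_le_mult_one_interval)
    fix t :: real assume "0 < t" "t < 1"
    then show "t * (\<kappa> / 2 * D) \<le> - ey - (cb - ca)"
      using first[of "1 - t"] by simp
  qed
  moreover have "\<kappa> / 2 * D \<le> - ex - (ca - cb)"
    using second by (rule field_le_mult_one_interval)
  ultimately have "\<kappa> * D \<le> - ex - ey" by simp
  also have "\<dots> = (\<integral>z. (a - b) \<bullet> (fst z - snd z) \<partial>\<gamma>)"
    using xv yv by (simp add: ex_def ey_def inner_diff_left inner_diff_right)
  \<comment> \<open>Young's inequality, weighted so that half of \<open>\<kappa> * D\<close> can be absorbed on the left.\<close>
  also have "\<dots> \<le> (\<integral>z. (norm (a - b))\<^sup>2 / (2 * \<kappa>) + \<kappa> / 2 * (dist (fst z) (snd z))\<^sup>2 \<partial>\<gamma>)"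
  proof (rule integral_mono)
    fix z :: "'a \<times> 'a"
    let ?n = "norm (a - b)" and ?d = "dist (fst z) (snd z)"
    have "(a - b) \<bullet> (fst z - snd z) \<le> ?n * ?d"
      by (simp add: dist_norm norm_cauchy_schwarz)
    also have "\<dots> \<le> ?n\<^sup>2 / (2 * \<kappa>) + \<kappa> / 2 * ?d\<^sup>2"
      using zero_le_power2[of "?n - \<kappa> * ?d"] \<kappa>
      by (simp add: field_simps power2_eq_square)
    finally show "(a - b) \<bullet> (fst z - snd z) \<le> ?n\<^sup>2 / (2 * \<kappa>) + \<kappa> / 2 * ?d\<^sup>2" .
  qed (use xv yv d2i in \<open>auto simp: inner_diff_right\<close>)
  also have "\<dots> = (norm (a - b))\<^sup>2 / (2 * \<kappa>) + \<kappa> / 2 * D"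
    using d2i by (simp add: D_def \<gamma>.prob_space)
  finally have "D \<le> (norm (a - b) / \<kappa>)\<^sup>2"
    using \<kappa> by (simp add: field_simps power2_eq_square)
  then have sqrt_D: "sqrt D \<le> norm (a - b) / \<kappa>"
    using \<kappa> by (intro real_le_lsqrt) auto
  have "\<gamma> \<in> couplings (density lborel f) (density lborel g)"
    by (simp add: couplings_def \<gamma>.prob_space_axioms sets_\<gamma> d1 d2)
  then have "wasserstein2 (density lborel f) (density lborel g)
      \<le> ennreal_sqrt (\<integral>\<^sup>+ z. ennreal ((dist (fst z) (snd z))\<^sup>2) \<partial>\<gamma>)"
    unfolding wasserstein2_def by (rule INF_lower)
  also have "(\<integral>\<^sup>+ z. ennreal ((dist (fst z) (snd z))\<^sup>2) \<partial>\<gamma>) = ennreal D"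
    unfolding D_def by (rule nn_integral_eq_integral[OF d2i]) simp
  also have "ennreal_sqrt (ennreal D) = ennreal (sqrt D)"
    by (simp add: ennreal_sqrt_def D_def)
  also have "\<dots> \<le> ennreal (norm (a - b) / \<kappa>)"
    using sqrt_D by (rule ennreal_leI)
  finally show ?thesis .
qed

section \<open>Strong convexity from a lower bound on the Hessian\<close>
lemma gradient_eqI:
  assumes "(f has_derivative (\<lambda>h. h \<bullet> D)) (at x)"
  shows "gradient f x = D"
  unfolding gradient_def gderiv_def
proof (rule the_equality)
  show "(f has_derivative (\<lambda>h. h \<bullet> D)) (at x)" by fact
  fix E assume "(f has_derivative (\<lambda>h. h \<bullet> E)) (at x)"
  from has_derivative_unique[OF this assms] have "h \<bullet> E = h \<bullet> D" for h
    by metis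
  then show "E = D" by (metis vector_eq_ldot inner_commute)
qed

lemma has_derivative_gradient:
  fixes f :: "real^'d \<Rightarrow> real"
  assumes "f differentiable at x"
  shows "(f has_derivative (\<lambda>h. h \<bullet> gradient f x)) (at x)"
proof -
  obtain f' where f': "(f has_derivative f') (at x)"
    using assms by (auto simp: differentiable_def)
  then have lin: "linear f'" by (rule has_derivative_linear)
  define D where "D = (\<Sum>b\<in>Basis. f' b *\<^sub>R b)"
  have "f' = (\<lambda>h. h \<bullet> D)"
  proof
    fix h
    have "f' h = f' (\<Sum>b\<in>Basis. (h \<bullet> b) *\<^sub>R b)"
      by (simp add: euclidean_representation)
    also have "\<dots> = h \<bullet> D"
      using lin by (simp add: linear_sum linear_scale D_def inner_sum_right mult.commute)
    finally show "f' h = h \<bullet> D" .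
  qed
  with f' have D: "(f has_derivative (\<lambda>h. h \<bullet> D)) (at x)"
    by simp
  with gradient_eqI[OF D] show ?thesis by simp
qed

text \<open>On the segment from \<open>x\<close> to \<open>y\<close>, subtracting \<open>c / 2 \<bar>y - x\<bar>\<^sup>2 r\<^sup>2\<close> leaves a function of \<open>r\<close> with nonnegative second
  derivative.\<close>
lemma strongly_convex_on_hessian:
  fixes f :: "real^'d \<Rightarrow> real"
  assumes S: "convex S"
    and d1: "\<And>x. x \<in> S \<Longrightarrow> f differentiable at x"
    and d2: "\<And>x. x \<in> S \<Longrightarrow> gradient f differentiable at x"
    and ge: "hessian_ge S f c"
  shows "strongly_convex_on S c f"
  unfolding strongly_convex_on_def
proof (intro conjI ballI allI impI S)
  fix x y :: "real^'d" and t :: real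
  assume xy: "x \<in> S" "y \<in> S" and t: "0 < t" "t < 1"
  define v where "v = y - x"
  define \<phi> where "\<phi> r = f (x + r *\<^sub>R v) - c / 2 * (v \<bullet> v) * r\<^sup>2" for r
  have seg: "x + r *\<^sub>R v \<in> S" if "r \<in> {0..1}" for r
  proof -
    have "x + r *\<^sub>R v = (1 - r) *\<^sub>R x + r *\<^sub>R y"
      by (simp add: v_def algebra_simps)
    then show ?thesis
      using S xy that by (auto simp: convex_alt)
  qed
  have line: "((\<lambda>r. x + r *\<^sub>R v) has_derivative (\<lambda>h. h *\<^sub>R v)) (at r)" for r
    by (auto intro!: derivative_eq_intros)
  have D1: "((\<lambda>r. f (x + r *\<^sub>R v)) has_field_derivative v \<bullet> gradient f (x + r *\<^sub>R v)) (at r)"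
    if "r \<in> {0..1}" for r
    using has_derivative_compose[OF line has_derivative_gradient[OF d1[OF seg[OF that]]]]
    by (simp add: has_field_derivative_def mult_commute_abs)
  have D2: "((\<lambda>r. v \<bullet> gradient f (x + r *\<^sub>R v)) has_field_derivative
      v \<bullet> (hessian f (x + r *\<^sub>R v) *v v)) (at r)" if "r \<in> {0..1}" for r
  proof -
    have "(gradient f has_derivative (\<lambda>h. hessian f (x + r *\<^sub>R v) *v h)) (at (x + r *\<^sub>R v))"
      unfolding hessian_def using d2[OF seg[OF that]] by (simp add: jacobian_works)
    from has_derivative_inner_right[OF has_derivative_compose[OF line this], of v] show ?thesis
      by (simp add: has_field_derivative_def matrix_vector_mult_scaleR mult_commute_abs)
  qed
  have "convex_on {0..1} \<phi>"
  proof (rule f''_ge0_imp_convex)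
    show "convex {0..1::real}" by simp
    fix r :: real assume r: "r \<in> {0..1}"
    show "(\<phi> has_field_derivative v \<bullet> gradient f (x + r *\<^sub>R v) - c * (v \<bullet> v) * r) (at r)"
      unfolding \<phi>_def by (rule derivative_eq_intros D1[OF r] | simp)+
    show "((\<lambda>r. v \<bullet> gradient f (x + r *\<^sub>R v) - c * (v \<bullet> v) * r) has_field_derivative
        v \<bullet> (hessian f (x + r *\<^sub>R v) *v v) - c * (v \<bullet> v)) (at r)"
      by (rule derivative_eq_intros D2[OF r] | simp)+
    show "0 \<le> v \<bullet> (hessian f (x + r *\<^sub>R v) *v v) - c * (v \<bullet> v)"
      using ge seg[OF r] by (auto simp: hessian_ge_def)
  qed
  then have "\<phi> ((1 - t) *\<^sub>R 0 + t *\<^sub>R 1) \<le> (1 - t) * \<phi> 0 + t * \<phi> 1"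
    using t by (intro convex_onD) auto
  moreover have "x + t *\<^sub>R v = (1 - t) *\<^sub>R x + t *\<^sub>R y" "x + v = y"
    by (simp_all add: v_def algebra_simps)
  moreover have "v \<bullet> v = (dist x y)\<^sup>2"
    by (metis dist_norm norm_minus_commute power2_norm_eq_inner v_def)
  ultimately have "f ((1 - t) *\<^sub>R x + t *\<^sub>R y) - c / 2 * (dist x y)\<^sup>2 * t\<^sup>2
      \<le> (1 - t) * f x + t * (f y - c / 2 * (dist x y)\<^sup>2)"
    by (simp add: \<phi>_def)
  then show "f ((1 - t) *\<^sub>R x + t *\<^sub>R y) \<le> (1 - t) * f x + t * f y - c / 2 * (dist x y)\<^sup>2 * t * (1 - t)"
    by (simp add: algebra_simps power2_eq_square diff_divide_distrib)
qed

text \<open>Divide the convexity inequality by the interpolation parameter and let it tend to \<open>0\<close>.\<close>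
lemma strongly_convex_on_tangent:
  assumes U: "strongly_convex_on S c U" and x: "x \<in> S" and y: "y \<in> S"
    and D: "(U has_derivative (\<lambda>h. h \<bullet> D)) (at x)"
  shows "U x + (y - x) \<bullet> D + c / 2 * (dist x y)\<^sup>2 \<le> U y"
proof -
  define v where "v = y - x"
  have line: "((\<lambda>r. x + r *\<^sub>R v) has_derivative (\<lambda>h. h *\<^sub>R v)) (at 0)"
    by (auto intro!: derivative_eq_intros)
  have "((\<lambda>r. U (x + r *\<^sub>R v)) has_field_derivative v \<bullet> D) (at 0)"
    using has_derivative_compose[OF line, of U "\<lambda>h. h \<bullet> D"] D
    by (simp add: has_field_derivative_def mult_commute_abs)
  then have "((\<lambda>r. (U (x + r *\<^sub>R v) - U x) / r) \<longlongrightarrow> v \<bullet> D) (at 0)"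
    by (simp add: has_field_derivative_iff)
  then have 1: "((\<lambda>r. (U (x + r *\<^sub>R v) - U x) / r) \<longlongrightarrow> v \<bullet> D) (at_right 0)"
    by (rule filterlim_mono) (simp_all add: at_le)
  have 2: "((\<lambda>r. U y - U x - c / 2 * (dist x y)\<^sup>2 * (1 - r)) \<longlongrightarrow> U y - U x - c / 2 * (dist x y)\<^sup>2 * (1 - 0)) (at_right 0)"
    by (intro tendsto_intros)
  have "v \<bullet> D \<le> U y - U x - c / 2 * (dist x y)\<^sup>2 * (1 - 0)"
  proof (rule tendsto_le[OF _ 2 1])
    show "\<forall>\<^sub>F r in at_right 0. (U (x + r *\<^sub>R v) - U x) / r \<le> U y - U x - c / 2 * (dist x y)\<^sup>2 * (1 - r)"
      using eventually_at_right_real[of 0 1]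
    proof (rule eventually_mono)
      fix r :: real assume "r \<in> {0<..<1}"
      then have r: "0 < r" "r < 1" by auto
      have "x + r *\<^sub>R v = (1 - r) *\<^sub>R x + r *\<^sub>R y"
        by (simp add: v_def algebra_simps)
      then have "U (x + r *\<^sub>R v) \<le> (1 - r) * U x + r * U y - c / 2 * (dist x y)\<^sup>2 * r * (1 - r)"
        using U x y r by (simp add: strongly_convex_on_def)
      then have "U (x + r *\<^sub>R v) - U x \<le> (U y - U x - c / 2 * (dist x y)\<^sup>2 * (1 - r)) * r"
        by (simp add: algebra_simps)
      with r show "(U (x + r *\<^sub>R v) - U x) / r \<le> U y - U x - c / 2 * (dist x y)\<^sup>2 * (1 - r)"
        by (simp add: pos_divide_le_eq)
    qed simp
  qed simp
  then show ?thesis by (simp add: v_def)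
qed

lemma strongly_convex_on_add:
  assumes "strongly_convex_on S c U" "strongly_convex_on S d V" "0 \<le> k"
  shows "strongly_convex_on S (k * c + d) (\<lambda>x. k * U x + V x)"
  unfolding strongly_convex_on_def
proof (intro conjI ballI allI impI)
  show "convex S" using assms by (simp add: strongly_convex_on_def)
  fix x y t assume *: "x \<in> S" "y \<in> S" "0 < t" "t < (1::real)"
  let ?z = "(1 - t) *\<^sub>R x + t *\<^sub>R y"
  have "k * U ?z \<le> k * ((1 - t) * U x + t * U y - c / 2 * (dist x y)\<^sup>2 * t * (1 - t))"
    using assms * by (intro mult_left_mono) (auto simp: strongly_convex_on_def)
  moreover have "V ?z \<le> (1 - t) * V x + t * V y - d / 2 * (dist x y)\<^sup>2 * t * (1 - t)"
    using assms * by (auto simp: strongly_convex_on_def)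
  ultimately show "k * U ?z + V ?z \<le> (1 - t) * (k * U x + V x) + t * (k * U y + V y)
      - (k * c + d) / 2 * (dist x y)\<^sup>2 * t * (1 - t)"
    by (simp add: field_simps)
qed

section \<open>Differentiability of Laplace transforms\<close>

lemma norm_integral_le_integral:
  fixes f :: "'x \<Rightarrow> 'b::{banach, second_countable_topology}"
  assumes "integrable M f" "integrable M g" "\<And>x. norm (f x) \<le> g x"
  shows "norm (\<integral>x. f x \<partial>M) \<le> (\<integral>x. g x \<partial>M)"
  using assms by (intro order_trans[OF integral_norm_bound integral_mono]) auto

text \<open>Exponential moments of the norm are controlled by those of finitely many linear forms: the norm is
  at most the dimension times the largest absolute coordinate.\<close>
lemma exp_norm_le_sum:
  fixes v :: "'a::euclidean_space"
  assumes "0 \<le> r"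
  shows "exp (r * norm v)
    \<le> (\<Sum>b\<in>Basis. exp (v \<bullet> ((r * DIM('a)) *\<^sub>R b)) + exp (v \<bullet> (- (r * DIM('a)) *\<^sub>R b)))"
proof -
  obtain b :: 'a where b: "b \<in> Basis" "\<And>c. c \<in> Basis \<Longrightarrow> \<bar>v \<bullet> c\<bar> \<le> \<bar>v \<bullet> b\<bar>"
  proof -
    have "Max ((\<lambda>c. \<bar>v \<bullet> c\<bar>) ` Basis) \<in> (\<lambda>c. \<bar>v \<bullet> c\<bar>) ` Basis"
      by (intro Max_in) auto
    then obtain b where b: "b \<in> Basis" "\<bar>v \<bullet> b\<bar> = Max ((\<lambda>c. \<bar>v \<bullet> c\<bar>) ` Basis)"
      by force
    have "\<bar>v \<bullet> c\<bar> \<le> \<bar>v \<bullet> b\<bar>" if "c \<in> Basis" for c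
      unfolding b(2) using that by (intro Max_ge) auto
    with b(1) that show thesis by blast
  qed
  have "norm v \<le> (\<Sum>c\<in>Basis. \<bar>v \<bullet> c\<bar>)" by (rule norm_le_l1)
  also have "\<dots> \<le> DIM('a) * \<bar>v \<bullet> b\<bar>"
    using sum_mono[of Basis "\<lambda>c. \<bar>v \<bullet> c\<bar>" "\<lambda>_. \<bar>v \<bullet> b\<bar>"] b by simp
  finally have "r * norm v \<le> r * DIM('a) * \<bar>v \<bullet> b\<bar>"
    using assms by (simp add: mult_left_mono mult.assoc)
  then have "exp (r * norm v) \<le> exp (r * DIM('a) * \<bar>v \<bullet> b\<bar>)" by simp
  also have "\<dots> \<le> exp (v \<bullet> ((r * DIM('a)) *\<^sub>R b)) + exp (v \<bullet> (- (r * DIM('a)) *\<^sub>R b))"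
    by (cases "0 \<le> v \<bullet> b") (auto simp: abs_if)
  also have "\<dots> \<le> (\<Sum>b\<in>Basis. exp (v \<bullet> ((r * DIM('a)) *\<^sub>R b)) + exp (v \<bullet> (- (r * DIM('a)) *\<^sub>R b)))"
    using b(1) by (intro member_le_sum) (auto intro: add_nonneg_nonneg)
  finally show ?thesis .
qed

lemma exp_second_order: "\<bar>exp s - 1 - s\<bar> \<le> s\<^sup>2 * exp \<bar>s\<bar>" for s :: real
proof -
  obtain t where t: "\<bar>t\<bar> \<le> \<bar>s\<bar>" "exp s = (\<Sum>m<2. s ^ m / fact m) + exp t / fact 2 * s ^ 2"
    using Maclaurin_exp_le[of s 2] by blast
  have "exp s - 1 - s = exp t / 2 * s\<^sup>2"
    using t(2) by (simp add: numeral_2_eq_2 lessThan_Suc)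
  then have "\<bar>exp s - 1 - s\<bar> = exp t / 2 * s\<^sup>2"
    by (simp only: abs_mult abs_divide abs_exp_cancel abs_numeral abs_power2)
  also have "\<dots> \<le> exp \<bar>s\<bar> * s\<^sup>2"
  proof (rule mult_right_mono)
    have "exp t \<le> exp \<bar>s\<bar>" "0 < exp t" using t(1) by auto
    then show "exp t / 2 \<le> exp \<bar>s\<bar>" by linarith
  qed simp
  finally show ?thesis by (simp add: mult.commute)
qed

definition laplace_domain :: "'x measure \<Rightarrow> ('x \<Rightarrow> 'a::euclidean_space) \<Rightarrow> 'a set" where
  "laplace_domain \<mu> T = {\<theta>. (\<integral>\<^sup>+ x. ennreal (exp (T x \<bullet> \<theta>)) \<partial>\<mu>) < \<infinity>}"

context
  fixes \<mu> :: "'x measure" and T :: "'x \<Rightarrow> 'a::euclidean_space"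
  assumes T [measurable]: "T \<in> borel_measurable \<mu>"
begin

lemma laplace_domain_iff: "\<theta> \<in> laplace_domain \<mu> T \<longleftrightarrow> integrable \<mu> (\<lambda>x. exp (T x \<bullet> \<theta>))"
  by (simp add: laplace_domain_def integrable_iff_bounded)

lemma convex_laplace_domain: "convex (laplace_domain \<mu> T)"
  unfolding convex_alt
proof (intro ballI allI impI)
  fix p q and u :: real
  assume pq: "p \<in> laplace_domain \<mu> T" "q \<in> laplace_domain \<mu> T" and u: "0 \<le> u \<and> u \<le> 1"
  show "(1 - u) *\<^sub>R p + u *\<^sub>R q \<in> laplace_domain \<mu> T"
    unfolding laplace_domain_iff
  proof (rule Bochner_Integration.integrable_bound)
    show "integrable \<mu> (\<lambda>x. (1 - u) * exp (T x \<bullet> p) + u * exp (T x \<bullet> q))"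
      using pq by (simp add: laplace_domain_iff)
    have "exp (T x \<bullet> ((1 - u) *\<^sub>R p + u *\<^sub>R q)) \<le> (1 - u) * exp (T x \<bullet> p) + u * exp (T x \<bullet> q)" for x
      using convex_onD[OF exp_convex, of u "T x \<bullet> p" "T x \<bullet> q"] u
      by (simp add: inner_add_right)
    then show "AE x in \<mu>. norm (exp (T x \<bullet> ((1 - u) *\<^sub>R p + u *\<^sub>R q)))
        \<le> norm ((1 - u) * exp (T x \<bullet> p) + u * exp (T x \<bullet> q))"
      using u by (auto simp: abs_of_nonneg)
  qed simp
qed

lemma exp_norm_integrable:
  assumes op: "open (laplace_domain \<mu> T)" and \<theta>: "\<theta> \<in> laplace_domain \<mu> T"
  shows "\<exists>r>0. integrable \<mu> (\<lambda>x. exp (T x \<bullet> \<theta> + r * norm (T x)))"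
proof -
  obtain e where e: "0 < e" "ball \<theta> e \<subseteq> laplace_domain \<mu> T"
    using op \<theta> by (meson open_contains_ball)
  define r where "r = e / (2 * DIM('a))"
  have r: "0 < r" "r * DIM('a) = e / 2"
    using e by (simp_all add: r_def)
  have dom: "\<theta> + (e / 2) *\<^sub>R b \<in> laplace_domain \<mu> T" "\<theta> - (e / 2) *\<^sub>R b \<in> laplace_domain \<mu> T"
    if "b \<in> Basis" for b
    using e that by (auto intro!: subsetD[OF e(2)] simp: dist_norm)
  have "integrable \<mu> (\<lambda>x. exp (T x \<bullet> \<theta> + r * norm (T x)))"
  proof (rule Bochner_Integration.integrable_bound)
    show "integrable \<mu> (\<lambda>x. \<Sum>b\<in>Basis. exp (T x \<bullet> (\<theta> + (e / 2) *\<^sub>R b)) + exp (T x \<bullet> (\<theta> - (e / 2) *\<^sub>R b)))"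
      using dom by (intro Bochner_Integration.integrable_sum Bochner_Integration.integrable_add)
        (auto simp: laplace_domain_iff)
    show "AE x in \<mu>. norm (exp (T x \<bullet> \<theta> + r * norm (T x)))
      \<le> norm (\<Sum>b\<in>Basis. exp (T x \<bullet> (\<theta> + (e / 2) *\<^sub>R b)) + exp (T x \<bullet> (\<theta> - (e / 2) *\<^sub>R b)))"
    proof (intro AE_I2)
      fix x
      have "exp (T x \<bullet> \<theta> + r * norm (T x)) = exp (T x \<bullet> \<theta>) * exp (r * norm (T x))"
        by (simp add: exp_add)
      also have "\<dots> \<le> exp (T x \<bullet> \<theta>) *
          (\<Sum>b\<in>Basis. exp (T x \<bullet> ((r * DIM('a)) *\<^sub>R b)) + exp (T x \<bullet> (- (r * DIM('a)) *\<^sub>R b)))"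
        using r by (intro mult_left_mono exp_norm_le_sum) auto
      also have "\<dots> = (\<Sum>b\<in>Basis. exp (T x \<bullet> (\<theta> + (e / 2) *\<^sub>R b)) + exp (T x \<bullet> (\<theta> - (e / 2) *\<^sub>R b)))"
        unfolding r sum_distrib_left
        by (intro sum.cong refl) (simp add: distrib_left inner_add_right inner_diff_right flip: exp_add)
      finally show "norm (exp (T x \<bullet> \<theta> + r * norm (T x)))
        \<le> norm (\<Sum>b\<in>Basis. exp (T x \<bullet> (\<theta> + (e / 2) *\<^sub>R b)) + exp (T x \<bullet> (\<theta> - (e / 2) *\<^sub>R b)))"
        by (simp add: abs_of_nonneg)
    qed
  qed simp
  with r show ?thesis by blast
qed

text \<open>Polynomial factors are absorbed by a small part of the exponential. Degree three is what the remainder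
  of the first-order expansion needs: two factors from the expansion and one from \<open>\<phi>\<close>
  in \<open>has_derivative_laplace\<close>.\<close>
lemma exp_norm_cubic_integrable:
  assumes op: "open (laplace_domain \<mu> T)" and \<theta>: "\<theta> \<in> laplace_domain \<mu> T"
  shows "\<exists>r>0. integrable \<mu> (\<lambda>x. (1 + norm (T x)) ^ 3 * exp (T x \<bullet> \<theta> + r * norm (T x)))"
proof -
  obtain r where r: "0 < r" "integrable \<mu> (\<lambda>x. exp (T x \<bullet> \<theta> + r * norm (T x)))"
    using exp_norm_integrable[OF assms] by blast
  \<comment> \<open>Three parts \<open>s\<close> of the exponent pay for the cubic factor, the fourth is kept.\<close>
  define s where "s = min (r / 4) 1"
  have s: "0 < s" "s \<le> 1" "4 * s \<le> r" using r by (auto simp: s_def)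
  have "integrable \<mu> (\<lambda>x. (1 + norm (T x)) ^ 3 * exp (T x \<bullet> \<theta> + s * norm (T x)))"
  proof (rule Bochner_Integration.integrable_bound)
    show "integrable \<mu> (\<lambda>x. (1 / s) ^ 3 * exp (T x \<bullet> \<theta> + r * norm (T x)))"
      using r by simp
    show "AE x in \<mu>. norm ((1 + norm (T x)) ^ 3 * exp (T x \<bullet> \<theta> + s * norm (T x)))
        \<le> norm ((1 / s) ^ 3 * exp (T x \<bullet> \<theta> + r * norm (T x)))"
    proof (intro AE_I2)
      fix x
      have "s * (1 + norm (T x)) \<le> 1 + s * norm (T x)" using s by (simp add: distrib_left)
      also have "\<dots> \<le> exp (s * norm (T x))" by (rule exp_ge_add_one_self)
      finally have "1 + norm (T x) \<le> 1 / s * exp (s * norm (T x))"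
        using s by (simp add: field_simps)
      then have "(1 + norm (T x)) ^ 3 \<le> (1 / s * exp (s * norm (T x))) ^ 3"
        by (intro power_mono) auto
      also have "\<dots> = (1 / s) ^ 3 * exp (3 * s * norm (T x))"
        by (simp add: power_divide power_mult_distrib exp_of_nat_mult[symmetric] mult.assoc)
      finally have "(1 + norm (T x)) ^ 3 * exp (T x \<bullet> \<theta> + s * norm (T x))
          \<le> (1 / s) ^ 3 * exp (3 * s * norm (T x)) * exp (T x \<bullet> \<theta> + s * norm (T x))"
        by (intro mult_right_mono) auto
      also have "\<dots> = (1 / s) ^ 3 * exp (T x \<bullet> \<theta> + 4 * s * norm (T x))"
        by (simp add: exp_add[symmetric] algebra_simps mult_exp_exp)
      also have "\<dots> \<le> (1 / s) ^ 3 * exp (T x \<bullet> \<theta> + r * norm (T x))"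
        using s by (intro mult_left_mono) (auto intro!: mult_right_mono)
      finally show "norm ((1 + norm (T x)) ^ 3 * exp (T x \<bullet> \<theta> + s * norm (T x)))
          \<le> norm ((1 / s) ^ 3 * exp (T x \<bullet> \<theta> + r * norm (T x)))"
        using s by (simp add: abs_mult)
    qed
  qed simp
  with s show ?thesis by blast
qed

text \<open>Differentiation under the integral sign. An integrable function \<open>B\<close> dominates the second-order remainder
  of the exponential uniformly for small increments \<open>v\<close>, up to the factor \<open>\<bar>v\<bar>\<^sup>2\<close>. The weight \<open>\<phi>\<close> may grow linearly, so that the
  result applies to the Laplace transform (\<open>\<phi> = 1\<close>) and again to its gradient (\<open>\<phi> = T\<close>).\<close>
lemma has_derivative_laplace:
  fixes \<phi> :: "'x \<Rightarrow> 'b::euclidean_space"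
  assumes op: "open (laplace_domain \<mu> T)" and \<theta>: "\<theta> \<in> laplace_domain \<mu> T"
    and \<phi> [measurable]: "\<phi> \<in> borel_measurable \<mu>" and bound: "\<And>x. norm (\<phi> x) \<le> 1 + norm (T x)"
  shows "((\<lambda>\<eta>. \<integral>x. exp (T x \<bullet> \<eta>) *\<^sub>R \<phi> x \<partial>\<mu>) has_derivative
    (\<lambda>v. \<integral>x. (T x \<bullet> v * exp (T x \<bullet> \<theta>)) *\<^sub>R \<phi> x \<partial>\<mu>)) (at \<theta>)"
    and "integrable \<mu> (\<lambda>x. exp (T x \<bullet> \<theta>) *\<^sub>R \<phi> x)"
proof -
  obtain r where r: "0 < r" and
    B: "integrable \<mu> (\<lambda>x. (1 + norm (T x)) ^ 3 * exp (T x \<bullet> \<theta> + r * norm (T x)))"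
    (is "integrable \<mu> ?B")
    using exp_norm_cubic_integrable[OF op \<theta>] by blast
  define K where "K = (\<integral>x. ?B x \<partial>\<mu>)"
  let ?F = "\<lambda>\<eta>. \<integral>x. exp (T x \<bullet> \<eta>) *\<^sub>R \<phi> x \<partial>\<mu>"
  let ?F' = "\<lambda>v. \<integral>x. (T x \<bullet> v * exp (T x \<bullet> \<theta>)) *\<^sub>R \<phi> x \<partial>\<mu>"
  have B0: "0 \<le> ?B x" for x by simp
  have p1: "norm (\<phi> x) \<le> (1 + norm (T x)) ^ 3" for x
  proof -
    have "(1 + norm (T x)) ^ 1 \<le> (1 + norm (T x)) ^ 3" by (rule power_increasing) auto
    with bound[of x] show ?thesis by simp
  qed
  have p2: "norm (T x) * norm (\<phi> x) \<le> (1 + norm (T x)) ^ 3" for x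
  proof -
    have "norm (T x) * norm (\<phi> x) \<le> (1 + norm (T x)) * (1 + norm (T x))"
      using bound[of x] by (intro mult_mono) auto
    also have "\<dots> \<le> (1 + norm (T x)) ^ 3"
      using power_increasing[of 2 3 "1 + norm (T x)"] by (simp add: power2_eq_square)
    finally show ?thesis .
  qed
  have p3: "(norm (T x))\<^sup>2 * norm (\<phi> x) \<le> (1 + norm (T x)) ^ 3" for x
  proof -
    have "(norm (T x))\<^sup>2 * norm (\<phi> x) \<le> (1 + norm (T x))\<^sup>2 * (1 + norm (T x))"
      using bound[of x] by (intro mult_mono power_mono) auto
    then show ?thesis by (simp add: power2_eq_square power3_eq_cube)
  qed
  have int0: "integrable \<mu> (\<lambda>x. exp (T x \<bullet> \<eta>) *\<^sub>R \<phi> x)" if \<eta>: "norm (\<eta> - \<theta>) \<le> r" for \<eta>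
  proof (rule Bochner_Integration.integrable_bound[OF B])
    show "AE x in \<mu>. norm (exp (T x \<bullet> \<eta>) *\<^sub>R \<phi> x) \<le> norm (?B x)"
    proof (intro AE_I2)
      fix x
      have "T x \<bullet> \<eta> = T x \<bullet> \<theta> + T x \<bullet> (\<eta> - \<theta>)" by (simp add: inner_diff_right)
      also have "T x \<bullet> (\<eta> - \<theta>) \<le> r * norm (T x)"
        using norm_cauchy_schwarz[of "T x" "\<eta> - \<theta>"] mult_left_mono[OF \<eta>, of "norm (T x)"]
        by (simp add: mult.commute)
      finally have "exp (T x \<bullet> \<eta>) \<le> exp (T x \<bullet> \<theta> + r * norm (T x))" by simp
      with p1[of x] have "norm (\<phi> x) * exp (T x \<bullet> \<eta>) \<le> ?B x"
        by (intro mult_mono) auto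
      then show "norm (exp (T x \<bullet> \<eta>) *\<^sub>R \<phi> x) \<le> norm (?B x)"
        by (simp add: mult.commute)
    qed
  qed simp
  then show "integrable \<mu> (\<lambda>x. exp (T x \<bullet> \<theta>) *\<^sub>R \<phi> x)"
    using r by simp
  have le1: "norm ((T x \<bullet> v * exp (T x \<bullet> \<theta>)) *\<^sub>R \<phi> x) \<le> ?B x * norm v" for x v
  proof -
    have "norm ((T x \<bullet> v * exp (T x \<bullet> \<theta>)) *\<^sub>R \<phi> x) = \<bar>T x \<bullet> v\<bar> * exp (T x \<bullet> \<theta>) * norm (\<phi> x)"
      by (simp add: abs_mult)
    also have "\<dots> \<le> (norm (T x) * norm v) * exp (T x \<bullet> \<theta>) * norm (\<phi> x)"
      by (intro mult_right_mono Cauchy_Schwarz_ineq2) auto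
    also have "\<dots> = (norm (T x) * norm (\<phi> x)) * exp (T x \<bullet> \<theta>) * norm v"
      by (simp add: mult_ac)
    also have "\<dots> \<le> (1 + norm (T x)) ^ 3 * exp (T x \<bullet> \<theta> + r * norm (T x)) * norm v"
      using p2[of x] r by (intro mult_right_mono mult_mono) auto
    finally show ?thesis .
  qed
  have int1: "integrable \<mu> (\<lambda>x. (T x \<bullet> v * exp (T x \<bullet> \<theta>)) *\<^sub>R \<phi> x)" for v
  proof (rule Bochner_Integration.integrable_bound)
    show "integrable \<mu> (\<lambda>x. ?B x * norm v)"
      using B by (rule integrable_mult_left)
    show "AE x in \<mu>. norm ((T x \<bullet> v * exp (T x \<bullet> \<theta>)) *\<^sub>R \<phi> x) \<le> norm (?B x * norm v)"
      by (intro AE_I2 order_trans[OF le1]) simp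
  qed measurable
  have lin: "bounded_linear ?F'"
  proof (rule bounded_linear_intro[where K = K])
    fix v w
    have "?F' (v + w) = (\<integral>x. (T x \<bullet> v * exp (T x \<bullet> \<theta>)) *\<^sub>R \<phi> x
        + (T x \<bullet> w * exp (T x \<bullet> \<theta>)) *\<^sub>R \<phi> x \<partial>\<mu>)"
      by (simp add: inner_add_right distrib_right scaleR_add_left)
    also have "\<dots> = ?F' v + ?F' w"
      using int1 int1 by (rule Bochner_Integration.integral_add)
    finally show "?F' (v + w) = ?F' v + ?F' w" .
  next
    fix c v
    have "?F' (c *\<^sub>R v) = (\<integral>x. c *\<^sub>R ((T x \<bullet> v * exp (T x \<bullet> \<theta>)) *\<^sub>R \<phi> x) \<partial>\<mu>)"
      by (simp add: mult.assoc)
    also have "\<dots> = c *\<^sub>R ?F' v"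
      by (rule integral_scaleR_right)
    finally show "?F' (c *\<^sub>R v) = c *\<^sub>R ?F' v" .
  next
    show "norm (?F' v) \<le> norm v * K" for v
    proof -
      have "norm (?F' v) \<le> (\<integral>x. ?B x * norm v \<partial>\<mu>)"
        by (intro norm_integral_le_integral int1 integrable_mult_left[OF B] le1)
      then show ?thesis by (simp add: K_def mult.commute)
    qed
  qed
  have rem: "norm (?F \<eta> - ?F \<theta> - ?F' (\<eta> - \<theta>)) \<le> K * (norm (\<eta> - \<theta>))\<^sup>2"
    if \<eta>: "norm (\<eta> - \<theta>) \<le> r" for \<eta>
  proof -
    let ?v = "\<eta> - \<theta>"
    let ?R = "\<lambda>x. exp (T x \<bullet> \<eta>) *\<^sub>R \<phi> x - exp (T x \<bullet> \<theta>) *\<^sub>R \<phi> x - (T x \<bullet> ?v * exp (T x \<bullet> \<theta>)) *\<^sub>R \<phi> x"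
    have eq: "?F \<eta> - ?F \<theta> - ?F' ?v = (\<integral>x. ?R x \<partial>\<mu>)"
    proof -
      have "integrable \<mu> (\<lambda>x. exp (T x \<bullet> \<theta>) *\<^sub>R \<phi> x)"
        using int0[of \<theta>] r by simp
      with int0[OF \<eta>] int1[of ?v] show ?thesis
        by (simp only: Bochner_Integration.integral_diff Bochner_Integration.integrable_diff)
    qed
    have "norm (?R x) \<le> ?B x * (norm ?v)\<^sup>2" for x
    proof -
      define s where "s = T x \<bullet> ?v"
      have s: "\<bar>s\<bar> \<le> norm (T x) * norm ?v"
        unfolding s_def by (rule Cauchy_Schwarz_ineq2)
      have "exp (T x \<bullet> \<eta>) = exp (T x \<bullet> \<theta>) * exp s"
        by (simp add: s_def inner_diff_right exp_diff)
      then have "?R x = (exp (T x \<bullet> \<theta>) * (exp s - 1 - s)) *\<^sub>R \<phi> x"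
        unfolding s_def[symmetric] by (simp add: algebra_simps)
      then have "norm (?R x) = exp (T x \<bullet> \<theta>) * \<bar>exp s - 1 - s\<bar> * norm (\<phi> x)"
        by (simp add: abs_mult)
      also have "\<dots> \<le> exp (T x \<bullet> \<theta>) * (s\<^sup>2 * exp \<bar>s\<bar>) * norm (\<phi> x)"
        by (intro mult_right_mono mult_left_mono exp_second_order) auto
      also have "\<dots> \<le> exp (T x \<bullet> \<theta>) * ((norm (T x) * norm ?v)\<^sup>2 * exp (r * norm (T x))) * norm (\<phi> x)"
      proof (intro mult_right_mono mult_left_mono mult_mono)
        show "s\<^sup>2 \<le> (norm (T x) * norm ?v)\<^sup>2"
          using s by (metis abs_ge_zero power2_abs power_mono)
        show "exp \<bar>s\<bar> \<le> exp (r * norm (T x))"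
          using s mult_left_mono[OF \<eta>, of "norm (T x)"] by (simp add: mult.commute)
      qed auto
      also have "\<dots> = ((norm (T x))\<^sup>2 * norm (\<phi> x)) * exp (T x \<bullet> \<theta> + r * norm (T x)) * (norm ?v)\<^sup>2"
        by (simp add: exp_add power_mult_distrib mult_ac)
      also have "\<dots> \<le> ?B x * (norm ?v)\<^sup>2"
        using p3[of x] by (intro mult_right_mono) auto
      finally show ?thesis .
    qed
    moreover have "integrable \<mu> ?R"
      using int0[OF \<eta>] int0[of \<theta>] int1[of ?v] r by (intro Bochner_Integration.integrable_diff) simp_all
    ultimately have "norm (\<integral>x. ?R x \<partial>\<mu>) \<le> (\<integral>x. ?B x * (norm ?v)\<^sup>2 \<partial>\<mu>)"
      by (intro norm_integral_le_integral integrable_mult_left[OF B])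
    then show ?thesis
      unfolding eq by (simp add: K_def)
  qed
  show "(?F has_derivative ?F') (at \<theta>)"
    unfolding has_derivative_iff_norm
  proof (intro conjI lin)
    have "((\<lambda>\<eta>. K * norm (\<eta> - \<theta>)) \<longlongrightarrow> K * norm (\<theta> - \<theta>)) (at \<theta>)"
      by (intro tendsto_intros)
    then have lim: "((\<lambda>\<eta>. K * norm (\<eta> - \<theta>)) \<longlongrightarrow> 0) (at \<theta>)" by simp
    show "((\<lambda>\<eta>. norm (?F \<eta> - ?F \<theta> - ?F' (\<eta> - \<theta>)) / norm (\<eta> - \<theta>)) \<longlongrightarrow> 0) (at \<theta>)"
    proof (rule tendsto_sandwich[OF _ _ tendsto_const lim])
      have "\<forall>\<^sub>F \<eta> in at \<theta>. \<eta> \<noteq> \<theta> \<and> norm (\<eta> - \<theta>) \<le> r"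
        using r unfolding eventually_at by (auto simp: dist_norm intro!: exI[of _ r])
      then show "\<forall>\<^sub>F \<eta> in at \<theta>. norm (?F \<eta> - ?F \<theta> - ?F' (\<eta> - \<theta>)) / norm (\<eta> - \<theta>) \<le> K * norm (\<eta> - \<theta>)"
      proof eventually_elim
        case (elim \<eta>)
        with rem[of \<eta>] show ?case
          by (simp add: divide_le_eq power2_eq_square mult.assoc)
      qed
    qed simp
  qed
qed

end

section \<open>The log-partition function and its gradient\<close>
definition log_laplace :: "'x measure \<Rightarrow> ('x \<Rightarrow> 'a::euclidean_space) \<Rightarrow> 'a \<Rightarrow> real" where
  "log_laplace \<mu> T \<theta> = ln (\<integral>x. exp (T x \<bullet> \<theta>) \<partial>\<mu>)"

context
  fixes \<mu> :: "'x measure" and T :: "'x \<Rightarrow> real^'d"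
  assumes T [measurable]: "T \<in> borel_measurable \<mu>" and nonnull: "emeasure \<mu> (space \<mu>) \<noteq> 0"
    and op: "open (laplace_domain \<mu> T)"
begin

lemma laplace_pos:
  assumes "\<theta> \<in> laplace_domain \<mu> T"
  shows "0 < (\<integral>x. exp (T x \<bullet> \<theta>) \<partial>\<mu>)"
proof -
  have int: "integrable \<mu> (\<lambda>x. exp (T x \<bullet> \<theta>))"
    using assms by (simp add: laplace_domain_iff)
  have "(\<integral>x. exp (T x \<bullet> \<theta>) \<partial>\<mu>) \<noteq> 0"
  proof
    assume "(\<integral>x. exp (T x \<bullet> \<theta>) \<partial>\<mu>) = 0"
    then have "AE x in \<mu>. False"
      using integral_nonneg_eq_0_iff_AE[OF int] by simp
    then show False
      using nonnull by (simp add: AE_iff_measurable[OF _ refl])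
  qed
  moreover have "0 \<le> (\<integral>x. exp (T x \<bullet> \<theta>) \<partial>\<mu>)"
    by (rule Bochner_Integration.integral_nonneg) simp
  ultimately show ?thesis by linarith
qed

lemma laplace_has_derivative:
  assumes \<theta>: "\<theta> \<in> laplace_domain \<mu> T"
  shows "((\<lambda>\<eta>. \<integral>x. exp (T x \<bullet> \<eta>) \<partial>\<mu>) has_derivative
    (\<lambda>v. v \<bullet> (\<integral>x. exp (T x \<bullet> \<theta>) *\<^sub>R T x \<partial>\<mu>))) (at \<theta>)"
    and "(\<lambda>\<eta>. \<integral>x. exp (T x \<bullet> \<eta>) *\<^sub>R T x \<partial>\<mu>) differentiable (at \<theta>)"
proof -
  have int: "integrable \<mu> (\<lambda>x. exp (T x \<bullet> \<theta>) *\<^sub>R T x)"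
    by (rule has_derivative_laplace(2)[OF T op \<theta> T]) simp
  have "(\<integral>x. T x \<bullet> v * exp (T x \<bullet> \<theta>) \<partial>\<mu>) = v \<bullet> (\<integral>x. exp (T x \<bullet> \<theta>) *\<^sub>R T x \<partial>\<mu>)" for v
    using int by (subst integral_inner_right[symmetric]) (auto simp: inner_commute mult.commute)
  then show "((\<lambda>\<eta>. \<integral>x. exp (T x \<bullet> \<eta>) \<partial>\<mu>) has_derivative
    (\<lambda>v. v \<bullet> (\<integral>x. exp (T x \<bullet> \<theta>) *\<^sub>R T x \<partial>\<mu>))) (at \<theta>)"
    using has_derivative_laplace(1)[OF T op \<theta>, of "\<lambda>_. 1 :: real"] by simp
  show "(\<lambda>\<eta>. \<integral>x. exp (T x \<bullet> \<eta>) *\<^sub>R T x \<partial>\<mu>) differentiable (at \<theta>)"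
    using has_derivative_laplace(1)[OF T op \<theta> T] by (auto simp: differentiable_def)
qed

lemma log_laplace_has_derivative:
  assumes \<theta>: "\<theta> \<in> laplace_domain \<mu> T"
  shows "(log_laplace \<mu> T has_derivative (\<lambda>v. v \<bullet>
    ((1 / (\<integral>x. exp (T x \<bullet> \<theta>) \<partial>\<mu>)) *\<^sub>R (\<integral>x. exp (T x \<bullet> \<theta>) *\<^sub>R T x \<partial>\<mu>)))) (at \<theta>)"
  unfolding log_laplace_def[abs_def]
  by (rule has_derivative_eq_rhs[OF has_derivative_ln[OF laplace_pos[OF \<theta>] laplace_has_derivative(1)[OF \<theta>]]])
     (simp add: fun_eq_iff divide_inverse mult.commute)

lemma log_laplace_differentiable:
  "\<theta> \<in> laplace_domain \<mu> T \<Longrightarrow> log_laplace \<mu> T differentiable (at \<theta>)"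
  using log_laplace_has_derivative by (auto simp: differentiable_def)

lemma gradient_log_laplace_differentiable:
  assumes \<theta>: "\<theta> \<in> laplace_domain \<mu> T"
  shows "gradient (log_laplace \<mu> T) differentiable (at \<theta>)"
proof -
  have "(\<lambda>\<eta>. \<integral>x. exp (T x \<bullet> \<eta>) \<partial>\<mu>) differentiable (at \<theta>)"
    using laplace_has_derivative(1)[OF \<theta>] by (auto simp: differentiable_def)
  with laplace_has_derivative(2)[OF \<theta>] laplace_pos[OF \<theta>]
  have "(\<lambda>\<eta>. (1 / (\<integral>x. exp (T x \<bullet> \<eta>) \<partial>\<mu>)) *\<^sub>R (\<integral>x. exp (T x \<bullet> \<eta>) *\<^sub>R T x \<partial>\<mu>))
      differentiable (at \<theta>)"
    by (intro differentiable_scaleR differentiable_divide) auto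
  then obtain G where "((\<lambda>\<eta>. (1 / (\<integral>x. exp (T x \<bullet> \<eta>) \<partial>\<mu>)) *\<^sub>R (\<integral>x. exp (T x \<bullet> \<eta>) *\<^sub>R T x \<partial>\<mu>))
      has_derivative G) (at \<theta>)"
    by (auto simp: differentiable_def)
  then have "(gradient (log_laplace \<mu> T) has_derivative G) (at \<theta>)"
    by (rule has_derivative_transform_within_open[OF _ op \<theta>])
       (rule gradient_eqI[OF log_laplace_has_derivative, symmetric])
  then show ?thesis
    by (auto simp: differentiable_def)
qed

text \<open>Fatou's lemma: a bound on the Laplace transform survives a limit of the parameters, and the finiteness
  thus obtained says that the limit lies in the domain. The domain being open, this rules out that a minimising
  sequence escapes to its boundary.\<close>
lemma laplace_sublevel:
  assumes \<theta>: "\<And>k. \<theta> k \<in> laplace_domain \<mu> T" and lim: "\<theta> \<longlonglongrightarrow> \<theta>'"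
    and le: "\<And>k. log_laplace \<mu> T (\<theta> k) - t \<bullet> \<theta> k \<le> c"
  shows "\<theta>' \<in> laplace_domain \<mu> T" and "log_laplace \<mu> T \<theta>' - t \<bullet> \<theta>' \<le> c"
proof -
  have le': "(\<integral>\<^sup>+ x. ennreal (exp (T x \<bullet> \<theta> k)) \<partial>\<mu>) \<le> ennreal (exp (c + t \<bullet> \<theta> k))" for k
  proof -
    have "(\<integral>x. exp (T x \<bullet> \<theta> k) \<partial>\<mu>) = exp (log_laplace \<mu> T (\<theta> k))"
      using laplace_pos[OF \<theta>] by (simp add: log_laplace_def)
    also have "\<dots> \<le> exp (c + t \<bullet> \<theta> k)"
      using le[of k] by simp
    finally have "(\<integral>x. exp (T x \<bullet> \<theta> k) \<partial>\<mu>) \<le> exp (c + t \<bullet> \<theta> k)" .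
    then show ?thesis
      using \<theta>[of k] by (subst nn_integral_eq_integral) (auto simp: laplace_domain_iff)
  qed
  have "(\<integral>\<^sup>+ x. ennreal (exp (T x \<bullet> \<theta>')) \<partial>\<mu>)
      = (\<integral>\<^sup>+ x. liminf (\<lambda>k. ennreal (exp (T x \<bullet> \<theta> k))) \<partial>\<mu>)"
    using lim by (intro nn_integral_cong lim_imp_Liminf[symmetric]) (auto intro!: tendsto_intros)
  also have "\<dots> \<le> liminf (\<lambda>k. \<integral>\<^sup>+ x. ennreal (exp (T x \<bullet> \<theta> k)) \<partial>\<mu>)"
    by (rule nn_integral_liminf) simp
  also have "\<dots> \<le> liminf (\<lambda>k. ennreal (exp (c + t \<bullet> \<theta> k)))"
    using le' by (intro Liminf_mono) auto
  also have "\<dots> = ennreal (exp (c + t \<bullet> \<theta>'))"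
    using lim by (intro lim_imp_Liminf) (auto intro!: tendsto_intros)
  finally have *: "(\<integral>\<^sup>+ x. ennreal (exp (T x \<bullet> \<theta>')) \<partial>\<mu>) \<le> ennreal (exp (c + t \<bullet> \<theta>'))" .
  then show dom: "\<theta>' \<in> laplace_domain \<mu> T"
    unfolding laplace_domain_def by (auto intro: le_less_trans)
  with * have "(\<integral>x. exp (T x \<bullet> \<theta>') \<partial>\<mu>) \<le> exp (c + t \<bullet> \<theta>')"
    by (subst (asm) nn_integral_eq_integral) (auto simp: laplace_domain_iff)
  then have "log_laplace \<mu> T \<theta>' \<le> ln (exp (c + t \<bullet> \<theta>'))"
    unfolding log_laplace_def using laplace_pos[OF dom] by (subst ln_le_cancel_iff) auto
  then show "log_laplace \<mu> T \<theta>' - t \<bullet> \<theta>' \<le> c" by simp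
qed

text \<open>A minimiser of \<open>J = M - t \<bullet> \<theta>\<close> is a point where the gradient of \<open>M\<close> is \<open>t\<close>. The sublevel set \<open>L\<close> of \<open>J\<close> is compact:
  bounded by the quadratic lower bound of strong convexity at \<open>\<theta>0\<close>, and closed by \<open>laplace_sublevel\<close>.\<close>
lemma gradient_log_laplace_surj:
  assumes ne: "laplace_domain \<mu> T \<noteq> {}" and c: "0 < c"
    and sc: "strongly_convex_on (laplace_domain \<mu> T) c (log_laplace \<mu> T)"
  shows "t \<in> gradient (log_laplace \<mu> T) ` laplace_domain \<mu> T"
proof -
  let ?\<Theta> = "laplace_domain \<mu> T" and ?M = "log_laplace \<mu> T"
  define J where "J \<theta> = ?M \<theta> - t \<bullet> \<theta>" for \<theta>
  obtain \<theta>0 where \<theta>0: "\<theta>0 \<in> ?\<Theta>" using ne by blast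
  define L where "L = {\<theta> \<in> ?\<Theta>. J \<theta> \<le> J \<theta>0}"
  define D where "D = gradient ?M \<theta>0 - t"
  have J_der: "(J has_derivative (\<lambda>h. h \<bullet> (gradient ?M \<theta> - t))) (at \<theta>)" if "\<theta> \<in> ?\<Theta>" for \<theta>
    unfolding J_def
    by (rule derivative_eq_intros has_derivative_gradient[OF log_laplace_differentiable[OF that]] refl)+
       (simp add: fun_eq_iff inner_diff_right inner_commute)
  have bd: "norm (\<theta> - \<theta>0) \<le> 2 / c * norm D" if "\<theta> \<in> L" for \<theta>
  proof -
    have "?M \<theta>0 + (\<theta> - \<theta>0) \<bullet> gradient ?M \<theta>0 + c / 2 * (dist \<theta>0 \<theta>)\<^sup>2 \<le> ?M \<theta>"
      using that \<theta>0 by (intro strongly_convex_on_tangent[OF sc]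
          has_derivative_gradient log_laplace_differentiable) (auto simp: L_def)
    moreover have "J \<theta> \<le> J \<theta>0" using that by (simp add: L_def)
    ultimately have "c / 2 * (norm (\<theta> - \<theta>0))\<^sup>2 \<le> - ((\<theta> - \<theta>0) \<bullet> D)"
      by (simp add: J_def D_def inner_diff_left inner_diff_right dist_norm norm_minus_commute inner_commute)
    also have "\<dots> \<le> norm (\<theta> - \<theta>0) * norm D"
      using Cauchy_Schwarz_ineq2[of "\<theta> - \<theta>0" D] by linarith
    finally have "norm (\<theta> - \<theta>0) * (c / 2 * norm (\<theta> - \<theta>0)) \<le> norm (\<theta> - \<theta>0) * norm D"
      by (simp add: power2_eq_square mult_ac)
    then have "\<theta> = \<theta>0 \<or> c / 2 * norm (\<theta> - \<theta>0) \<le> norm D"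
      using mult_left_le_imp_le[of "norm (\<theta> - \<theta>0)" "c / 2 * norm (\<theta> - \<theta>0)" "norm D"]
      by (cases "\<theta> = \<theta>0") simp_all
    then show ?thesis
      using c by (auto simp: field_simps)
  qed
  have "compact L"
    unfolding compact_eq_bounded_closed
  proof
    show "bounded L"
      using bd by (intro bounded_subset[OF bounded_cball[of \<theta>0 "2 / c * norm D"]])
        (auto simp: dist_norm norm_minus_commute)
    show "closed L"
      unfolding closed_sequential_limits
    proof (intro allI impI)
      fix \<theta> l assume *: "(\<forall>n. \<theta> n \<in> L) \<and> \<theta> \<longlonglongrightarrow> l"
      then show "l \<in> L"
        using laplace_sublevel[of \<theta> l t "J \<theta>0"] by (auto simp: L_def J_def)
    qed
  qed
  moreover have "L \<noteq> {}" using \<theta>0 by (auto simp: L_def)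
  moreover have "continuous_on L J"
    using J_der by (intro continuous_at_imp_continuous_on ballI has_derivative_continuous) (auto simp: L_def)
  ultimately obtain m where m: "m \<in> L" "\<And>\<theta>. \<theta> \<in> L \<Longrightarrow> J m \<le> J \<theta>"
    using continuous_attains_inf[of L J] by blast
  then have m': "m \<in> ?\<Theta>" by (simp add: L_def)
  have min: "J m \<le> J \<theta>" if "\<theta> \<in> ?\<Theta>" for \<theta>
    using m that \<theta>0 by (cases "\<theta> \<in> L") (fastforce simp: L_def)+
  have "(\<lambda>h. h \<bullet> (gradient ?M m - t)) = (\<lambda>h. 0)"
    using differential_zero_maxmin[OF m' op J_der[OF m']] min by blast
  then have "(gradient ?M m - t) \<bullet> (gradient ?M m - t) = 0"
    by metis
  then show ?thesis
    using m' by auto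
qed

end

section \<open>Posterior distributions\<close>

text \<open>The second moment controls the tilted density outside the unit ball. Inside, the exponent is bounded
  above by the tangent of the convex function \<open>U\<close> at a point \<open>x0\<close>, even if \<open>S\<close> has boundary points there.\<close>
lemma integrable_tilt:
  fixes S :: "'a::euclidean_space set"
  assumes \<kappa>: "0 < \<kappa>" and U: "strongly_convex_on S \<kappa> U" and S: "open S" "S \<noteq> {}"
    and der: "\<And>x. x \<in> S \<Longrightarrow> \<exists>D. (U has_derivative (\<lambda>h. h \<bullet> D)) (at x)"
    and second: "(\<integral>\<^sup>+ \<theta>\<in>S. ennreal ((norm \<theta>)\<^sup>2 * exp (a \<bullet> \<theta> - U \<theta>)) \<partial>lborel) < \<infinity>"
  shows "(\<lambda>\<theta>. indicator S \<theta> * exp (a \<bullet> \<theta> - U \<theta>)) \<in> borel_measurable borel"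
    and "(\<integral>\<^sup>+ \<theta>. ennreal (indicator S \<theta> * exp (a \<bullet> \<theta> - U \<theta>)) \<partial>lborel) < \<infinity>"
    and "(\<integral>\<^sup>+ \<theta>. ennreal (indicator S \<theta> * exp (a \<bullet> \<theta> - U \<theta>)) \<partial>lborel) \<noteq> 0"
proof -
  let ?g = "\<lambda>\<theta>. indicator S \<theta> * exp (a \<bullet> \<theta> - U \<theta>)"
  have "continuous_on S U"
    using der by (intro continuous_at_imp_continuous_on ballI) (blast dest: has_derivative_continuous)
  then have "continuous_on S (\<lambda>\<theta>. exp (a \<bullet> \<theta> - U \<theta>))"
    by (intro continuous_intros)
  from borel_measurable_continuous_on_indicator[OF _ this] S
  show [measurable]: "?g \<in> borel_measurable borel" by simp
  have [measurable]: "S \<in> sets borel" "cball (0::'a) 1 \<in> sets borel" using S by simp_all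
  obtain x0 where x0: "x0 \<in> S" using S by blast
  obtain D where D: "(U has_derivative (\<lambda>h. h \<bullet> D)) (at x0)" using der[OF x0] by blast
  define C where "C = exp (norm a - U x0 + (1 + norm x0) * norm D)"
  have "?g \<theta> \<le> C * indicator (cball 0 1) \<theta> + indicator S \<theta> * ((norm \<theta>)\<^sup>2 * exp (a \<bullet> \<theta> - U \<theta>))" for \<theta>
  proof (cases "\<theta> \<in> S")
    case True
    show ?thesis
    proof (cases "norm \<theta> \<le> 1")
      case n: True
      have "U x0 + (\<theta> - x0) \<bullet> D + \<kappa> / 2 * (dist x0 \<theta>)\<^sup>2 \<le> U \<theta>"
        by (rule strongly_convex_on_tangent[OF U x0 True D])
      moreover have "0 \<le> \<kappa> / 2 * (dist x0 \<theta>)\<^sup>2" using \<kappa> by simp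
      moreover have "- ((\<theta> - x0) \<bullet> D) \<le> (1 + norm x0) * norm D"
      proof -
        have "- ((\<theta> - x0) \<bullet> D) \<le> norm (\<theta> - x0) * norm D"
          using Cauchy_Schwarz_ineq2[of "\<theta> - x0" D] by linarith
        also have "\<dots> \<le> (1 + norm x0) * norm D"
          using n norm_triangle_ineq4[of \<theta> x0] by (intro mult_right_mono) auto
        finally show ?thesis .
      qed
      moreover have "a \<bullet> \<theta> \<le> norm a"
        using norm_cauchy_schwarz[of a \<theta>] mult_left_mono[OF n, of "norm a"] by simp
      ultimately have "exp (a \<bullet> \<theta> - U \<theta>) \<le> C"
        unfolding C_def by simp
      moreover have "0 \<le> (norm \<theta>)\<^sup>2 * exp (a \<bullet> \<theta> - U \<theta>)" by simp
      ultimately have "exp (a \<bullet> \<theta> - U \<theta>) \<le> C + (norm \<theta>)\<^sup>2 * exp (a \<bullet> \<theta> - U \<theta>)" by linarith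
      then show ?thesis using True n by (simp add: indicator_def)
    next
      case False
      then have "1 * exp (a \<bullet> \<theta> - U \<theta>) \<le> (norm \<theta>)\<^sup>2 * exp (a \<bullet> \<theta> - U \<theta>)"
        by (intro mult_right_mono) (auto simp: one_le_power)
      then show ?thesis using True False by (simp add: indicator_def)
    qed
  qed (simp add: C_def)
  then have "(\<integral>\<^sup>+ \<theta>. ennreal (?g \<theta>) \<partial>lborel) \<le> (\<integral>\<^sup>+ \<theta>. ennreal C * indicator (cball 0 1) \<theta>
      + ennreal (norm \<theta> ^ 2) * ennreal (?g \<theta>) \<partial>lborel)"
  proof (intro nn_integral_mono)
    fix \<theta>
    assume "\<And>\<theta>. ?g \<theta> \<le> C * indicator (cball 0 1) \<theta> + indicator S \<theta> * ((norm \<theta>)\<^sup>2 * exp (a \<bullet> \<theta> - U \<theta>))"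
    from ennreal_leI[OF this[of \<theta>]]
    show "ennreal (?g \<theta>) \<le> ennreal C * indicator (cball 0 1) \<theta> + ennreal (norm \<theta> ^ 2) * ennreal (?g \<theta>)"
      by (auto simp: indicator_def C_def ennreal_mult' ennreal_plus split: if_splits)
  qed
  also have "\<dots> = ennreal C * emeasure lborel (cball (0::'a) 1) + (\<integral>\<^sup>+ \<theta>. ennreal (norm \<theta> ^ 2) * ennreal (?g \<theta>) \<partial>lborel)"
    by (subst nn_integral_add) (auto simp: nn_integral_cmult)
  also have "(\<integral>\<^sup>+ \<theta>. ennreal (norm \<theta> ^ 2) * ennreal (?g \<theta>) \<partial>lborel)
      = (\<integral>\<^sup>+ \<theta>\<in>S. ennreal ((norm \<theta>)\<^sup>2 * exp (a \<bullet> \<theta> - U \<theta>)) \<partial>lborel)"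
    by (intro nn_integral_cong) (auto simp: indicator_def ennreal_mult')
  also have "ennreal C * emeasure lborel (cball (0::'a) 1) + \<dots> < \<infinity>"
    using second emeasure_lborel_cball_finite[of "0::'a" 1] by (auto simp: ennreal_mult_less_top less_top)
  finally show "(\<integral>\<^sup>+ \<theta>. ennreal (?g \<theta>) \<partial>lborel) < \<infinity>" .
  show "(\<integral>\<^sup>+ \<theta>. ennreal (?g \<theta>) \<partial>lborel) \<noteq> 0"
  proof
    assume "(\<integral>\<^sup>+ \<theta>. ennreal (?g \<theta>) \<partial>lborel) = 0"
    then have "AE \<theta> in lborel. ennreal (?g \<theta>) = 0"
      by (subst (asm) nn_integral_0_iff_AE) auto
    then have "AE \<theta> in lborel. \<theta> \<notin> S"
      by eventually_elim (auto simp: indicator_def ennreal_eq_0_iff split: if_splits)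
    then have "emeasure lborel S = 0"
      by (subst (asm) AE_iff_measurable[where N = S]) auto
    then show False
      using open_not_negligible[OF S] by (simp add: negligible_iff_null_sets null_sets_def)
  qed
qed

lemma mean_stat_inner:
  assumes "1 \<le> n"
  shows "(\<Sum>i=1..n. T (x i)) = real n *\<^sub>R mean_stat T n x"
  using assms by (simp add: mean_stat_def)

lemma likelihood_eq:
  assumes "1 \<le> n"
  shows "(\<Prod>i=1..n. exp_density X T h (x i) \<theta>)
    = exp (real n *\<^sub>R mean_stat T n x \<bullet> \<theta> - real n * log_partition X T h \<theta>) * (\<Prod>i=1..n. h (x i))"
proof -
  have "(\<Prod>i=1..n. exp_density X T h (x i) \<theta>)
      = exp (\<Sum>i=1..n. T (x i) \<bullet> \<theta> - log_partition X T h \<theta>) * (\<Prod>i=1..n. h (x i))"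
    by (simp add: exp_density_def prod.distrib exp_sum)
  also have "(\<Sum>i=1..n. T (x i) \<bullet> \<theta> - log_partition X T h \<theta>)
      = (\<Sum>i=1..n. T (x i)) \<bullet> \<theta> - real n * log_partition X T h \<theta>"
    by (simp add: sum_subtractf inner_sum_left)
  finally show ?thesis
    by (simp only: mean_stat_inner[OF assms])
qed

text \<open>Bayes' formula in closed form. The factor \<open>\<Prod>h(x\<^sub>i)\<close> of the likelihood cancels against the evidence,
  so only \<open>z\<close>, the integral of the tilted prior, remains as normaliser.\<close>
lemma posterior_eq_density:
  fixes X :: "(real^'m) set" and T :: "real^'m \<Rightarrow> real^'d" and W :: "real^'d \<Rightarrow> real"
  assumes n: "1 \<le> n" and x: "x \<in> samples X n" and h: "\<forall>x\<in>X. h x > 0"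
    and M: "log_partition X T h \<in> borel_measurable borel"
    and op: "open (nat_params X T h)" and W: "continuous_on (nat_params X T h) W"
    and z: "0 < z" "(\<integral>\<^sup>+ \<theta>. ennreal (indicator (nat_params X T h) \<theta> * exp (real n *\<^sub>R mean_stat T n x \<bullet> \<theta>
        - (real n * log_partition X T h \<theta> + W \<theta>))) \<partial>lborel) = ennreal z"
  shows "posterior X T h W n x = density lborel (\<lambda>\<theta>. ennreal (indicator (nat_params X T h) \<theta> *
    exp (real n *\<^sub>R mean_stat T n x \<bullet> \<theta> - (real n * log_partition X T h \<theta> + W \<theta>) - ln z)))"
proof -
  let ?\<Theta> = "nat_params X T h" and ?M = "log_partition X T h"
  let ?a = "real n *\<^sub>R mean_stat T n x"
  define H where "H = (\<Prod>i=1..n. h (x i))"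
  have H: "0 < H"
    unfolding H_def using x h by (intro prod_pos) (auto simp: samples_def)
  define L where "L \<theta> = ennreal (\<Prod>i=1..n. exp_density X T h (x i) \<theta>)" for \<theta>
  have L: "L \<theta> = ennreal (exp (?a \<bullet> \<theta> - real n * ?M \<theta>) * H)" for \<theta>
    unfolding L_def H_def likelihood_eq[OF n] ..
  note M [measurable]
  have [measurable]: "L \<in> borel_measurable borel"
    unfolding L[abs_def] by measurable
  let ?p = "\<lambda>\<theta>. ennreal (exp (- W \<theta>)) * indicator ?\<Theta> \<theta>"
  have "(\<lambda>\<theta>. indicator ?\<Theta> \<theta> *\<^sub>R exp (- W \<theta>)) \<in> borel_measurable borel"
    using W op by (intro borel_measurable_continuous_on_indicator continuous_intros) auto
  then have "(\<lambda>\<theta>. ennreal (indicator ?\<Theta> \<theta> *\<^sub>R exp (- W \<theta>))) \<in> borel_measurable borel"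
    by (rule measurable_compose) simp
  also have "(\<lambda>\<theta>. ennreal (indicator ?\<Theta> \<theta> *\<^sub>R exp (- W \<theta>))) = ?p"
    by (auto simp: indicator_def)
  finally have p [measurable]: "?p \<in> borel_measurable borel" .
  have pL: "?p \<theta> * L \<theta> = ennreal H * ennreal (indicator ?\<Theta> \<theta> * exp (?a \<bullet> \<theta> - (real n * ?M \<theta> + W \<theta>)))" for \<theta>
    using H by (simp add: L indicator_def exp_diff exp_add exp_minus field_simps flip: ennreal_mult')
  have "(\<integral>\<^sup>+ \<theta>. L \<theta> \<partial>prior ?\<Theta> W) = (\<integral>\<^sup>+ \<theta>. ?p \<theta> * L \<theta> \<partial>lborel)"
    unfolding prior_def by (rule nn_integral_density) auto
  also have "\<dots> = ennreal H * (\<integral>\<^sup>+ \<theta>. ennreal (indicator ?\<Theta> \<theta> * exp (?a \<bullet> \<theta> - (real n * ?M \<theta> + W \<theta>))) \<partial>lborel)"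
  proof -
    have "(\<lambda>\<theta>. ?p \<theta> * L \<theta> / ennreal H) \<in> borel_measurable borel" by measurable
    also have "(\<lambda>\<theta>. ?p \<theta> * L \<theta> / ennreal H) = (\<lambda>\<theta>. ennreal (indicator ?\<Theta> \<theta> * exp (?a \<bullet> \<theta> - (real n * ?M \<theta> + W \<theta>))))"
      unfolding pL using H by (simp add: ennreal_mult_divide_eq mult.commute[of "ennreal H"])
    finally show ?thesis
      unfolding pL by (intro nn_integral_cmult) simp
  qed
  also have "\<dots> = ennreal (H * z)"
    unfolding z(2) using H z by (simp add: ennreal_mult)
  finally have Z: "(\<integral>\<^sup>+ \<theta>. L \<theta> \<partial>prior ?\<Theta> W) = ennreal (H * z)" .
  have "posterior X T h W n x = density (prior ?\<Theta> W) (\<lambda>\<theta>. L \<theta> / ennreal (H * z))"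
    unfolding posterior_def Let_def L_def[symmetric] Z ..
  also have "\<dots> = density lborel (\<lambda>\<theta>. ?p \<theta> * (L \<theta> / ennreal (H * z)))"
    unfolding prior_def by (rule density_density_eq) auto
  also have "(\<lambda>\<theta>. ?p \<theta> * (L \<theta> / ennreal (H * z)))
      = (\<lambda>\<theta>. ennreal (indicator ?\<Theta> \<theta> * exp (?a \<bullet> \<theta> - (real n * ?M \<theta> + W \<theta>) - ln z)))"
  proof
    fix \<theta>
    have "?p \<theta> * (L \<theta> / ennreal (H * z)) = ennreal H * ennreal (indicator ?\<Theta> \<theta> * exp (?a \<bullet> \<theta> - (real n * ?M \<theta> + W \<theta>))) / ennreal (H * z)"
      by (simp only: ennreal_times_divide pL)
    also have "\<dots> = ennreal (H * (indicator ?\<Theta> \<theta> * exp (?a \<bullet> \<theta> - (real n * ?M \<theta> + W \<theta>))) / (H * z))"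
      using H z by (simp add: divide_ennreal flip: ennreal_mult')
    also have "H * (indicator ?\<Theta> \<theta> * exp (?a \<bullet> \<theta> - (real n * ?M \<theta> + W \<theta>))) / (H * z)
        = indicator ?\<Theta> \<theta> * exp (?a \<bullet> \<theta> - (real n * ?M \<theta> + W \<theta>) - ln z)"
      using H z by (simp add: exp_diff[of _ "ln z"])
    finally show "?p \<theta> * (L \<theta> / ennreal (H * z))
      = ennreal (indicator ?\<Theta> \<theta> * exp (?a \<bullet> \<theta> - (real n * ?M \<theta> + W \<theta>) - ln z))" .
  qed
  finally show ?thesis .
qed

text \<open>With the weight \<open>h\<close> absorbed into the measure, the natural parameters and the log-partition function of
  the family are those of a Laplace transform.\<close>
lemma base_measure:
  fixes X :: "(real^'m) set" and T :: "real^'m \<Rightarrow> real^'d"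
  assumes X: "X \<noteq> {}" "open X" and T: "T \<in> borel_measurable (lebesgue_on X)"
    and h: "h \<in> borel_measurable (lebesgue_on X)" "\<forall>x\<in>X. h x > 0"
  defines "\<mu> \<equiv> density (lebesgue_on X) (\<lambda>x. ennreal (h x))"
  shows "T \<in> borel_measurable \<mu>" and "emeasure \<mu> (space \<mu>) \<noteq> 0"
    and "nat_params X T h = laplace_domain \<mu> T" and "log_partition X T h = log_laplace \<mu> T"
proof -
  note [measurable] = T h(1)
  have XL: "X \<in> sets lebesgue" using X by auto
  show [measurable]: "T \<in> borel_measurable \<mu>" by (simp add: \<mu>_def)
  show "emeasure \<mu> (space \<mu>) \<noteq> 0"
  proof
    assume "emeasure \<mu> (space \<mu>) = 0"
    then have "(\<integral>\<^sup>+ x. 1 \<partial>\<mu>) = 0" by simp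
    then have "(\<integral>\<^sup>+ x. ennreal (h x) \<partial>lebesgue_on X) = 0"
      unfolding \<mu>_def by (subst (asm) nn_integral_density) auto
    then have "AE x in lebesgue_on X. ennreal (h x) = 0"
      by (subst (asm) nn_integral_0_iff_AE) auto
    then have "AE x in lebesgue_on X. False"
      using AE_space by eventually_elim (use h in \<open>auto simp: ennreal_eq_0_iff not_le[symmetric]\<close>)
    then have "emeasure (lebesgue_on X) X = 0"
      by (subst (asm) AE_iff_measurable[where N = X]) (auto simp: sets_restrict_space)
    then have "emeasure lebesgue X = 0"
      using XL by (subst (asm) emeasure_restrict_space) auto
    then show False
      using open_not_negligible[OF X(2,1)] XL by (simp add: negligible_iff_null_sets null_sets_def)
  qed
  have "(\<integral>\<^sup>+ x\<in>X. ennreal (exp (T x \<bullet> \<theta>) * h x) \<partial>lebesgue) = (\<integral>\<^sup>+ x. ennreal (exp (T x \<bullet> \<theta>)) \<partial>\<mu>)" for \<theta>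
  proof -
    have "(\<integral>\<^sup>+ x\<in>X. ennreal (exp (T x \<bullet> \<theta>) * h x) \<partial>lebesgue)
        = (\<integral>\<^sup>+ x. ennreal (exp (T x \<bullet> \<theta>) * h x) \<partial>lebesgue_on X)"
      using XL by (subst nn_integral_restrict_space) auto
    also have "\<dots> = (\<integral>\<^sup>+ x. ennreal (h x) * ennreal (exp (T x \<bullet> \<theta>)) \<partial>lebesgue_on X)"
      using h(2) by (intro nn_integral_cong) (simp add: ennreal_mult'' mult.commute)
    also have "\<dots> = (\<integral>\<^sup>+ x. ennreal (exp (T x \<bullet> \<theta>)) \<partial>\<mu>)"
      unfolding \<mu>_def by (rule nn_integral_density[symmetric]) auto
    finally show ?thesis .
  qed
  then show "nat_params X T h = laplace_domain \<mu> T"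
    by (simp add: nat_params_def laplace_domain_def)
  have "(LINT x:X|lebesgue. exp (T x \<bullet> \<theta>) * h x) = (\<integral>x. exp (T x \<bullet> \<theta>) \<partial>\<mu>)" for \<theta>
  proof -
    have "(LINT x:X|lebesgue. exp (T x \<bullet> \<theta>) * h x) = (\<integral>x. exp (T x \<bullet> \<theta>) * h x \<partial>lebesgue_on X)"
      unfolding set_lebesgue_integral_def using XL by (subst integral_restrict_space) auto
    also have "\<dots> = (\<integral>x. h x *\<^sub>R exp (T x \<bullet> \<theta>) \<partial>lebesgue_on X)"
      by (simp add: mult.commute)
    also have "\<dots> = (\<integral>x. exp (T x \<bullet> \<theta>) \<partial>\<mu>)"
    proof -
      have "AE x in lebesgue_on X. 0 \<le> h x"
        using h(2) by (intro AE_I2) (simp add: less_imp_le)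
      then show ?thesis
        unfolding \<mu>_def by (intro integral_density[symmetric]) auto
    qed
    finally show ?thesis .
  qed
  then show "log_partition X T h = log_laplace \<mu> T"
    by (simp add: fun_eq_iff log_partition_def log_laplace_def)
qed

theorem proposition3p1:
  fixes X :: "(real^'m) set"
    and T :: "real^'m \<Rightarrow> real^'d"
    and h :: "real^'m \<Rightarrow> real"
    and W :: "real^'d \<Rightarrow> real"
    and \<alpha> lam :: real
  defines "\<Theta> \<equiv> nat_params X T h"
    and "M \<equiv> log_partition X T h"
    and "\<Lambda> \<equiv> mean_params X T h"
  assumes X: "X \<noteq> {}" "convex X" "open X"
    and T: "T \<in> borel_measurable (lebesgue_on X)"
    and h: "h \<in> borel_measurable (lebesgue_on X)" "\<forall>x\<in>X. h x > 0"
    and Theta: "\<Theta> \<noteq> {}" "open \<Theta>"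
    and Lambda: "\<Lambda> \<noteq> {}"
    and W: "C2_on \<Theta> W"
    and prior: "prob_space (prior \<Theta> W)"
    and alpha: "\<alpha> > 0"
    and hess_M: "hessian_ge \<Theta> M \<alpha>"
    and hess_W: "hessian_ge \<Theta> W lam"
    and second_moment: "\<forall>n\<ge>1. \<forall>x\<in>samples X n.
      (\<integral>\<^sup>+ \<theta>\<in>\<Theta>. ennreal ((norm \<theta>)\<^sup>2 *
          exp (real n * (mean_stat T n x \<bullet> \<theta> - M \<theta>) - W \<theta>)) \<partial>lborel) < \<infinity>"
  shows "(\<forall>n\<ge>1. real n > - lam / \<alpha> \<longrightarrow> (\<forall>x\<in>samples X n. \<forall>y\<in>samples X n.
            wasserstein2 (posterior X T h W n x) (posterior X T h W n y)
              \<le> ennreal (real n / (real n * \<alpha> + lam)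
                    * norm (mean_stat T n x - mean_stat T n y)))) \<and>
         (\<forall>l. l-lipschitz_on \<Theta> (gradient M) \<longrightarrow>
            (\<forall>n\<ge>1. real n > - lam / \<alpha> \<longrightarrow> (\<forall>x\<in>samples X n. \<forall>y\<in>samples X n.
              mean_stat T n x \<in> \<Lambda> \<longrightarrow> mean_stat T n y \<in> \<Lambda> \<longrightarrow>
              wasserstein2 (posterior X T h W n x) (posterior X T h W n y)
                \<le> ennreal (real n * l / (real n * \<alpha> + lam)
                      * norm (mle X T h n x - mle X T h n y)))))"
proof -
  define \<mu> where "\<mu> = density (lebesgue_on X) (\<lambda>x. ennreal (h x))"
  note base = base_measure[OF X(1,3) T h, folded \<mu>_def]
  have \<Theta>_eq: "\<Theta> = laplace_domain \<mu> T" and M_eq: "M = log_laplace \<mu> T"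
    by (simp_all add: \<Theta>_def M_def base)
  have op: "open (laplace_domain \<mu> T)" using Theta(2) \<Theta>_eq by simp
  have conv: "convex \<Theta>"
    unfolding \<Theta>_eq by (rule convex_laplace_domain[OF base(1)])
  have M_diff: "M differentiable (at \<theta>)" "gradient M differentiable (at \<theta>)" if "\<theta> \<in> \<Theta>" for \<theta>
    using that log_laplace_differentiable[OF base(1,2) op]
      gradient_log_laplace_differentiable[OF base(1,2) op] by (simp_all add: \<Theta>_eq M_eq)
  have W_diff: "W differentiable (at \<theta>)" "gradient W differentiable (at \<theta>)" if "\<theta> \<in> \<Theta>" for \<theta>
    using that W by (simp_all add: C2_on_def)
  have sc_M: "strongly_convex_on \<Theta> \<alpha> M"
    using conv M_diff hess_M by (rule strongly_convex_on_hessian)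
  have sc_W: "strongly_convex_on \<Theta> lam W"
    using conv W_diff hess_W by (rule strongly_convex_on_hessian)
  have cont: "continuous_on \<Theta> M" "continuous_on \<Theta> W"
    using M_diff(1) W_diff(1)
    by (auto intro!: continuous_at_imp_continuous_on differentiable_imp_continuous_within)
  \<comment> \<open>Outside \<open>\<Theta>\<close> the integral diverges, hence is \<open>0\<close> by convention, and \<open>M\<close> is the constant \<open>ln 0\<close>.\<close>
  have M_meas: "M \<in> borel_measurable borel"
  proof -
    have "(\<lambda>\<theta>. indicator \<Theta> \<theta> *\<^sub>R M \<theta>) \<in> borel_measurable borel"
      using Theta(2) cont(1) by (intro borel_measurable_continuous_on_indicator) auto
    then have "(\<lambda>\<theta>. indicator \<Theta> \<theta> *\<^sub>R M \<theta> + indicator (- \<Theta>) \<theta> * ln 0) \<in> borel_measurable borel"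
      using Theta(2) by (intro borel_measurable_add) auto
    also have "(\<lambda>\<theta>. indicator \<Theta> \<theta> *\<^sub>R M \<theta> + indicator (- \<Theta>) \<theta> * ln 0) = M"
      by (auto simp: fun_eq_iff indicator_def M_eq \<Theta>_eq log_laplace_def
          laplace_domain_iff[OF base(1)] not_integrable_integral_eq)
    finally show ?thesis .
  qed
  have first: "wasserstein2 (posterior X T h W n x) (posterior X T h W n y)
      \<le> ennreal (real n / (real n * \<alpha> + lam) * norm (mean_stat T n x - mean_stat T n y))"
    if n: "1 \<le> n" "real n > - lam / \<alpha>" and x: "x \<in> samples X n" and y: "y \<in> samples X n" for n x y
  proof -
    define \<kappa> where "\<kappa> = real n * \<alpha> + lam"
    define V where "V \<theta> = real n * M \<theta> + W \<theta>" for \<theta>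
    have \<kappa>: "0 < \<kappa>"
      using iffD1[OF pos_divide_less_eq[OF alpha] n(2)] by (simp add: \<kappa>_def)
    have sc: "strongly_convex_on \<Theta> \<kappa> V"
      unfolding \<kappa>_def V_def by (rule strongly_convex_on_add[OF sc_M sc_W]) simp
    have V_der: "\<exists>D. (V has_derivative (\<lambda>h. h \<bullet> D)) (at \<theta>)" if "\<theta> \<in> \<Theta>" for \<theta>
    proof -
      have "V differentiable (at \<theta>)"
        unfolding V_def using M_diff(1)[OF that] W_diff(1)[OF that]
        by (intro differentiable_add differentiable_mult) auto
      then show ?thesis using has_derivative_gradient by blast
    qed
    have ex: "\<exists>c. posterior X T h W n s = density lborel (\<lambda>\<theta>. ennreal (indicator \<Theta> \<theta> * exp (real n *\<^sub>R mean_stat T n s \<bullet> \<theta> - V \<theta> - c)))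
      \<and> prob_density lborel (\<lambda>\<theta>. indicator \<Theta> \<theta> * exp (real n *\<^sub>R mean_stat T n s \<bullet> \<theta> - V \<theta> - c))
      \<and> (\<integral>\<^sup>+ \<theta>. ennreal ((norm \<theta>)\<^sup>2 * (indicator \<Theta> \<theta> * exp (real n *\<^sub>R mean_stat T n s \<bullet> \<theta> - V \<theta> - c))) \<partial>lborel) < \<infinity>"
      if s: "s \<in> samples X n" for s
    proof -
      let ?a = "real n *\<^sub>R mean_stat T n s"
      let ?g = "\<lambda>\<theta>. indicator \<Theta> \<theta> * exp (?a \<bullet> \<theta> - V \<theta>)"
      have second: "(\<integral>\<^sup>+ \<theta>\<in>\<Theta>. ennreal ((norm \<theta>)\<^sup>2 * exp (?a \<bullet> \<theta> - V \<theta>)) \<partial>lborel) < \<infinity>"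
        using second_moment n(1) s by (simp add: V_def algebra_simps)
      note g = integrable_tilt[OF \<kappa> sc Theta(2,1) V_der second]
      define z where "z = enn2real (\<integral>\<^sup>+ \<theta>. ennreal (?g \<theta>) \<partial>lborel)"
      have z: "(\<integral>\<^sup>+ \<theta>. ennreal (?g \<theta>) \<partial>lborel) = ennreal z"
        using g(2) by (simp add: z_def)
      have z0: "0 < z"
        using g(3) unfolding z by (simp add: ennreal_eq_0_iff)
      note [measurable] = g(1)
      have c: "indicator \<Theta> \<theta> * exp (?a \<bullet> \<theta> - V \<theta> - ln z) = ?g \<theta> / z" for \<theta>
        using z0 by (simp add: exp_diff[of _ "ln z"])
      have "posterior X T h W n s = density lborel (\<lambda>\<theta>. ennreal (indicator \<Theta> \<theta> * exp (?a \<bullet> \<theta> - V \<theta> - ln z)))"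
        using z0 z M_meas Theta(2) cont(2) unfolding V_def M_def \<Theta>_def
        by (intro posterior_eq_density[OF n(1) s h(2)])
      moreover have "(\<integral>\<^sup>+ \<theta>. ennreal (?g \<theta> / z) \<partial>lborel) = 1"
      proof -
        have "(\<integral>\<^sup>+ \<theta>. ennreal (?g \<theta> / z) \<partial>lborel) = (\<integral>\<^sup>+ \<theta>. ennreal (?g \<theta>) / ennreal z \<partial>lborel)"
          using z0 by (simp add: divide_ennreal)
        also have "\<dots> = (\<integral>\<^sup>+ \<theta>. ennreal (?g \<theta>) \<partial>lborel) / ennreal z"
          by (rule nn_integral_divide) measurable
        also have "\<dots> = ennreal z / ennreal z"
          by (simp only: z)
        finally show ?thesis
          using z0 by (simp add: divide_ennreal)
      qed
      moreover have "(\<integral>\<^sup>+ \<theta>. ennreal ((norm \<theta>)\<^sup>2 * (?g \<theta> / z)) \<partial>lborel) < \<infinity>"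
      proof -
        have [measurable]: "(\<lambda>\<theta>. ennreal ((norm \<theta>)\<^sup>2 * ?g \<theta>)) \<in> borel_measurable borel" by measurable
        have "(\<integral>\<^sup>+ \<theta>. ennreal ((norm \<theta>)\<^sup>2 * (?g \<theta> / z)) \<partial>lborel)
            = (\<integral>\<^sup>+ \<theta>. ennreal (1 / z) * ennreal ((norm \<theta>)\<^sup>2 * ?g \<theta>) \<partial>lborel)"
          using z0 by (intro nn_integral_cong) (simp flip: ennreal_mult')
        also have "\<dots> = ennreal (1 / z) * (\<integral>\<^sup>+ \<theta>. ennreal ((norm \<theta>)\<^sup>2 * ?g \<theta>) \<partial>lborel)"
          by (rule nn_integral_cmult) measurable
        also have "(\<integral>\<^sup>+ \<theta>. ennreal ((norm \<theta>)\<^sup>2 * ?g \<theta>) \<partial>lborel)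
            = (\<integral>\<^sup>+ \<theta>\<in>\<Theta>. ennreal ((norm \<theta>)\<^sup>2 * exp (?a \<bullet> \<theta> - V \<theta>)) \<partial>lborel)"
          by (intro nn_integral_cong) (auto simp: indicator_def)
        finally show ?thesis
          using second by (simp add: ennreal_mult_less_top)
      qed
      moreover have "prob_density lborel (\<lambda>\<theta>. ?g \<theta> / z)"
        unfolding prob_density_def
      proof (intro conjI allI)
        show "(\<lambda>\<theta>. ?g \<theta> / z) \<in> borel_measurable lborel"
          unfolding measurable_lborel2 by measurable
        show "(\<integral>\<^sup>+ \<theta>. ennreal (?g \<theta> / z) \<partial>lborel) = 1" by fact
      qed (use z0 in simp)
      ultimately show ?thesis
        by (intro exI[of _ "ln z"]) (simp only: c simp_thms)
    qed
    obtain ca where ca: "posterior X T h W n x = density lborel (\<lambda>\<theta>. ennreal (indicator \<Theta> \<theta> * exp (real n *\<^sub>R mean_stat T n x \<bullet> \<theta> - V \<theta> - ca)))"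
      "prob_density lborel (\<lambda>\<theta>. indicator \<Theta> \<theta> * exp (real n *\<^sub>R mean_stat T n x \<bullet> \<theta> - V \<theta> - ca))"
      "(\<integral>\<^sup>+ \<theta>. ennreal ((norm \<theta>)\<^sup>2 * (indicator \<Theta> \<theta> * exp (real n *\<^sub>R mean_stat T n x \<bullet> \<theta> - V \<theta> - ca))) \<partial>lborel) < \<infinity>"
      using ex[OF x] by blast
    obtain cb where cb: "posterior X T h W n y = density lborel (\<lambda>\<theta>. ennreal (indicator \<Theta> \<theta> * exp (real n *\<^sub>R mean_stat T n y \<bullet> \<theta> - V \<theta> - cb)))"
      "prob_density lborel (\<lambda>\<theta>. indicator \<Theta> \<theta> * exp (real n *\<^sub>R mean_stat T n y \<bullet> \<theta> - V \<theta> - cb))"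
      "(\<integral>\<^sup>+ \<theta>. ennreal ((norm \<theta>)\<^sup>2 * (indicator \<Theta> \<theta> * exp (real n *\<^sub>R mean_stat T n y \<bullet> \<theta> - V \<theta> - cb))) \<partial>lborel) < \<infinity>"
      using ex[OF y] by blast
    have "wasserstein2 (posterior X T h W n x) (posterior X T h W n y)
        \<le> ennreal (norm (real n *\<^sub>R mean_stat T n x - real n *\<^sub>R mean_stat T n y) / \<kappa>)"
      unfolding ca(1) cb(1)
      by (rule wasserstein2_tilted_le[OF \<kappa> sc ca(2) cb(2) refl refl ca(3) cb(3)])
    also have "norm (real n *\<^sub>R mean_stat T n x - real n *\<^sub>R mean_stat T n y) / \<kappa>
        = real n / \<kappa> * norm (mean_stat T n x - mean_stat T n y)"
      by (simp flip: scaleR_diff_right)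
    finally show ?thesis
      by (simp add: \<kappa>_def)
  qed
  have mle: "mle X T h n s \<in> \<Theta>" "gradient M (mle X T h n s) = mean_stat T n s" for n s
  proof -
    have "mean_stat T n s \<in> gradient M ` \<Theta>"
      unfolding M_eq \<Theta>_eq
      using Theta(1) alpha sc_M unfolding M_eq \<Theta>_eq
      by (intro gradient_log_laplace_surj[OF base(1,2) op])
    then show "mle X T h n s \<in> \<Theta>" "gradient M (mle X T h n s) = mean_stat T n s"
      unfolding mle_def \<Theta>_def[symmetric] M_def[symmetric]
      by (auto intro: inv_into_into f_inv_into_f)
  qed
  have second: "wasserstein2 (posterior X T h W n x) (posterior X T h W n y)
      \<le> ennreal (real n * l / (real n * \<alpha> + lam) * norm (mle X T h n x - mle X T h n y))"
    if l: "l-lipschitz_on \<Theta> (gradient M)" and n: "1 \<le> n" "real n > - lam / \<alpha>"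
      and x: "x \<in> samples X n" and y: "y \<in> samples X n" for l n x y
  proof -
    have \<kappa>: "0 < real n * \<alpha> + lam"
      using iffD1[OF pos_divide_less_eq[OF alpha] n(2)] by simp
    have "norm (mean_stat T n x - mean_stat T n y) \<le> l * norm (mle X T h n x - mle X T h n y)"
      using lipschitz_onD[OF l mle(1) mle(1), of n x n y] by (simp add: mle(2) dist_norm)
    then have "real n / (real n * \<alpha> + lam) * norm (mean_stat T n x - mean_stat T n y)
        \<le> real n / (real n * \<alpha> + lam) * (l * norm (mle X T h n x - mle X T h n y))"
      using \<kappa> by (intro mult_left_mono) auto
    then have "real n / (real n * \<alpha> + lam) * norm (mean_stat T n x - mean_stat T n y)
        \<le> real n * l / (real n * \<alpha> + lam) * norm (mle X T h n x - mle X T h n y)"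
      by simp
    then show ?thesis
      using first[OF n x y] by (meson ennreal_leI order_trans)
  qed
  show ?thesis
    using first second by blast
qed

end
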